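(* Let $p\in\mathbb{N}$ and let $J$ be the periodic Jacobi operator on $\ell^2(\mathbb{Z})$ with real $p$-periodic coefficient sequences $\{a_i\}_{i\in\mathbb{Z}}$, $\{b_i\}_{i\in\mathbb{Z}}$, $\{c_i\}_{i\in\mathbb{Z}}$, and suppose there is a constant $k$ with $b_i-c_i=k$ for every $i=0,1,\ldots,p-1$. If $\Lambda_\epsilon(J)$ is path-connected for some $\epsilon\ge |k|$, then $$\omega_a\le 2(\epsilon+|k|)(p-1).$$
   Context: For real sequences $\{a_i\},\{b_i\},\{c_i\}$ indexed by $\mathbb{Z}$ with $a_{i+p}=a_i$, $b_{i+p}=b_i$, $c_{i+p}=c_i$ for all $i$, the periodic Jacobi operator $J$ is the bounded (in general non-normal) linear operator on the complex Hilbert space $\ell^2(\mathbb{Z})$ given by the tridiagonal matrix with $$(Ju)_n=c_{n-1}u_{n-1}+a_nu_n+b_nu_{n+1},\qquad n\in\mathbb{Z}.$$ For a bounded operator $A$ on a complex Hilbert space with spectrum $\sigma(A)$ and $\epsilon>0$, the $\epsilon$-pseudospectrum is $$\Lambda_\epsilon(A)=\sigma(A)\cup\{z\in\mathbb{C}:\ z\notin\sigma(A),\ \|(zI-A)^{-1}\|\ge \epsilon^{-1}\},$$ and $\Lambda_0(A)=\sigma(A)$. Notation: $\omega_a=\max\{|a_i-a_j|: i,j=0,1,2,\ldots\}$. *)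

theory Defs
  imports "HOL-Analysis.Analysis"
begin

section \<open>The Hilbert space of square-summable complex sequences indexed by the integers\<close>

typedef ell2 = "{u :: int \<Rightarrow> complex. (\<lambda>n. (cmod (u n))\<^sup>2) summable_on UNIV}"
  morphisms coord Abs_ell2
  by (rule exI[of _ "\<lambda>_. 0"]) simp

setup_lifting type_definition_ell2

lemma ell2_eqI: "(\<And>n. coord u n = coord v n) \<Longrightarrow> u = v"
  by (metis coord_inject ext)

lemma coord_summable: "(\<lambda>n. (cmod (coord u n))\<^sup>2) summable_on UNIV"
  using coord[of u] by simp

lemma square_summable_add:
  fixes u v :: "int \<Rightarrow> complex"
  assumes "(\<lambda>n. (cmod (u n))\<^sup>2) summable_on UNIV" "(\<lambda>n. (cmod (v n))\<^sup>2) summable_on UNIV"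
  shows "(\<lambda>n. (cmod (u n + v n))\<^sup>2) summable_on UNIV"
proof (rule summable_on_comparison_test)
  show "(\<lambda>n. 2 * (cmod (u n))\<^sup>2 + 2 * (cmod (v n))\<^sup>2) summable_on UNIV"
    by (intro summable_on_add summable_on_cmult_right assms)
  fix n
  have "(cmod (u n + v n))\<^sup>2 \<le> (cmod (u n) + cmod (v n))\<^sup>2"
    by (intro power_mono norm_triangle_ineq) auto
  also have "\<dots> \<le> 2 * (cmod (u n))\<^sup>2 + 2 * (cmod (v n))\<^sup>2"
    using sum_squares_ge_zero[of "cmod (u n) - cmod (v n)" 0]
    by (simp add: power2_eq_square algebra_simps)
  finally show "(cmod (u n + v n))\<^sup>2 \<le> 2 * (cmod (u n))\<^sup>2 + 2 * (cmod (v n))\<^sup>2" .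
qed auto

lemma square_summable_bounded_mult:
  fixes u v :: "int \<Rightarrow> complex"
  assumes "(\<lambda>n. (cmod (u n))\<^sup>2) summable_on UNIV" "\<And>n. cmod (v n) \<le> K"
  shows "(\<lambda>n. (cmod (v n * u n))\<^sup>2) summable_on UNIV"
proof (rule summable_on_comparison_test)
  show "(\<lambda>n. K\<^sup>2 * (cmod (u n))\<^sup>2) summable_on UNIV"
    by (intro summable_on_cmult_right assms)
  show "(cmod (v n * u n))\<^sup>2 \<le> K\<^sup>2 * (cmod (u n))\<^sup>2" for n
    using assms(2)[of n] by (auto simp: norm_mult power_mult_distrib intro!: mult_right_mono power_mono)
qed auto

lemma square_summable_shift:
  fixes u :: "int \<Rightarrow> complex"
  assumes "(\<lambda>n. (cmod (u n))\<^sup>2) summable_on UNIV"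
  shows "(\<lambda>n. (cmod (u (n + d)))\<^sup>2) summable_on UNIV"
proof -
  have "bij (\<lambda>n::int. n + d)"
    by (rule bij_betwI[of _ _ _ "\<lambda>n. n - d"]) auto
  then show ?thesis
    using assms summable_on_reindex_bij_betw[of "\<lambda>n. n + d" UNIV UNIV "\<lambda>n. (cmod (u n))\<^sup>2"] by simp
qed

lift_definition scaleC_ell2 :: "complex \<Rightarrow> ell2 \<Rightarrow> ell2"  (infixr "*\<^sub>C" 75)
  is "\<lambda>z u n. z * u n"
  by (rule square_summable_bounded_mult[where K = "cmod z" for z]) auto

instantiation ell2 :: real_inner
begin

lift_definition zero_ell2 :: ell2 is "\<lambda>_. 0" by simp
lift_definition plus_ell2 :: "ell2 \<Rightarrow> ell2 \<Rightarrow> ell2" is "\<lambda>u v n. u n + v n"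
  by (rule square_summable_add)
lift_definition uminus_ell2 :: "ell2 \<Rightarrow> ell2" is "\<lambda>u n. - u n" by simp
lift_definition minus_ell2 :: "ell2 \<Rightarrow> ell2 \<Rightarrow> ell2" is "\<lambda>u v n. u n - v n"
  using square_summable_add[of u "\<lambda>n. - v n" for u v] by simp
lift_definition scaleR_ell2 :: "real \<Rightarrow> ell2 \<Rightarrow> ell2" is "\<lambda>r u n. r *\<^sub>R u n"
  by (simp add: power_mult_distrib summable_on_cmult_right)

definition norm_ell2 :: "ell2 \<Rightarrow> real"
  where "norm u = sqrt (\<Sum>\<^sub>\<infinity>n. (cmod (coord u n))\<^sup>2)"

(* The real part of the complex inner product; it induces the norm above. *)
definition inner_ell2 :: "ell2 \<Rightarrow> ell2 \<Rightarrow> real"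
  where "inner u v = (\<Sum>\<^sub>\<infinity>n. Re (coord u n * cnj (coord v n)))"

definition sgn_ell2 :: "ell2 \<Rightarrow> ell2"
  where "sgn u = inverse (norm u) *\<^sub>R (u :: ell2)"
definition dist_ell2 :: "ell2 \<Rightarrow> ell2 \<Rightarrow> real"
  where "dist u v = norm (u - v :: ell2)"
definition uniformity_ell2 :: "(ell2 \<times> ell2) filter"
  where "uniformity_ell2 = (INF e\<in>{0<..}. principal {(x :: ell2, y). dist x y < e})"
definition open_ell2 :: "ell2 set \<Rightarrow> bool"
  where "open_ell2 (U :: ell2 set) = (\<forall>x\<in>U. eventually (\<lambda>(x', y). x' = x \<longrightarrow> y \<in> U) uniformity)"

lemma inner_summable: "(\<lambda>n. Re (coord u n * cnj (coord v n))) summable_on UNIV"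
proof (rule abs_summable_summable, rule Infinite_Sum.abs_summable_on_comparison_test')
  show "(\<lambda>n. (cmod (coord u n))\<^sup>2 + (cmod (coord v n))\<^sup>2) summable_on UNIV"
    by (intro summable_on_add coord_summable)
  fix n
  have "norm (Re (coord u n * cnj (coord v n))) \<le> cmod (coord u n) * cmod (coord v n)"
    using abs_Re_le_cmod[of "coord u n * cnj (coord v n)"] by (simp add: norm_mult)
  also have "\<dots> \<le> (cmod (coord u n))\<^sup>2 + (cmod (coord v n))\<^sup>2"
    using sum_squares_bound[of "cmod (coord u n)" "cmod (coord v n)"]
      mult_nonneg_nonneg[of "cmod (coord u n)" "cmod (coord v n)"]
    by (simp del: mult_nonneg_nonneg)
  finally show "norm (Re (coord u n * cnj (coord v n))) \<le> (cmod (coord u n))\<^sup>2 + (cmod (coord v n))\<^sup>2" .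
qed

lemma inner_self_ell2: "inner u u = (\<Sum>\<^sub>\<infinity>n. (cmod (coord u n))\<^sup>2)" for u :: ell2
  unfolding inner_ell2_def by (simp add: complex_mult_cnj cmod_power2 flip: power2_eq_square)

instance
proof
  fix u v w :: ell2 and r s :: real
  show "u + v + w = u + (v + w)" "u + v = v + u" "0 + u = u" "- u + u = 0" "u - v = u + - v"
    by (transfer; simp add: algebra_simps)+
  show "r *\<^sub>R (u + v) = r *\<^sub>R u + r *\<^sub>R v" "(r + s) *\<^sub>R u = r *\<^sub>R u + s *\<^sub>R u"
    "r *\<^sub>R s *\<^sub>R u = (r * s) *\<^sub>R u" "1 *\<^sub>R u = u"
    by (transfer; simp add: algebra_simps)+
  show "dist u v = norm (u - v)" "sgn u = inverse (norm u) *\<^sub>R u"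
    by (simp_all add: dist_ell2_def sgn_ell2_def)
  show "uniformity = (INF e\<in>{0<..}. principal {(x :: ell2, y). dist x y < e})"
    by (rule uniformity_ell2_def)
  show "open U = (\<forall>x\<in>U. eventually (\<lambda>(x', y). x' = x \<longrightarrow> y \<in> U) uniformity)" for U :: "ell2 set"
    by (rule open_ell2_def)
  show "inner u v = inner v u"
    unfolding inner_ell2_def by (intro infsum_cong) (simp add: algebra_simps)
  show "inner (u + v) w = inner u w + inner v w"
    unfolding inner_ell2_def
    by (subst infsum_add[symmetric, OF inner_summable inner_summable])
       (simp add: plus_ell2.rep_eq algebra_simps)
  show "inner (r *\<^sub>R u) v = r * inner u v"
    unfolding inner_ell2_def
    by (subst infsum_cmult_right'[symmetric]) (simp add: scaleR_ell2.rep_eq algebra_simps)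
  show "0 \<le> inner u u"
    unfolding inner_self_ell2 by (rule infsum_nonneg) simp
  show "inner u u = 0 \<longleftrightarrow> u = 0"
  proof
    assume 0: "inner u u = 0"
    have "(cmod (coord u n))\<^sup>2 = 0" for n
      by (rule nonneg_infsum_le_0D[OF _ coord_summable[of u]])
         (use 0 in \<open>simp_all add: inner_self_ell2\<close>)
    then show "u = 0" by (intro ell2_eqI) (simp add: zero_ell2.rep_eq)
  qed (simp add: inner_ell2_def zero_ell2.rep_eq)
  show "norm u = sqrt (inner u u)"
    by (simp add: inner_self_ell2 norm_ell2_def)
qed

end

lemmas coord_simps [simp] =
  zero_ell2.rep_eq plus_ell2.rep_eq uminus_ell2.rep_eq minus_ell2.rep_eq
  scaleR_ell2.rep_eq scaleC_ell2.rep_eq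

lemma norm_ell2_sq: "(norm u)\<^sup>2 = (\<Sum>\<^sub>\<infinity>n. (cmod (coord u n))\<^sup>2)" for u :: ell2
  unfolding norm_ell2_def by (simp add: infsum_nonneg)

lemma sum_coord_le_norm_sq:
  "finite F \<Longrightarrow> (\<Sum>n\<in>F. (cmod (coord u n))\<^sup>2) \<le> (norm u)\<^sup>2"
  unfolding norm_ell2_sq by (rule finite_sum_le_infsum[OF coord_summable]) auto

lemma norm_coord_le: "cmod (coord u n) \<le> norm u"
  by (rule power2_le_imp_le) (use sum_coord_le_norm_sq[of "{n}" u] in auto)

instance ell2 :: banach
proof
  fix X :: "nat \<Rightarrow> ell2"
  assume X: "Cauchy X"
  have "Cauchy (\<lambda>m. coord (X m) n)" for n
  proof (rule metric_CauchyI)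
    fix e :: real assume "e > 0"
    then obtain M where M: "\<And>m m'. m \<ge> M \<Longrightarrow> m' \<ge> M \<Longrightarrow> dist (X m) (X m') < e"
      using metric_CauchyD[OF X] by blast
    show "\<exists>M. \<forall>m\<ge>M. \<forall>m'\<ge>M. dist (coord (X m) n) (coord (X m') n) < e"
    proof (intro exI allI impI)
      fix m m' assume "m \<ge> M" "m' \<ge> M"
      from M[OF this] norm_coord_le[of "X m - X m'" n]
      show "dist (coord (X m) n) (coord (X m') n) < e" by (simp add: dist_norm)
    qed
  qed
  then have "\<exists>l. (\<lambda>m. coord (X m) n) \<longlonglongrightarrow> l" for n
    by (simp add: Cauchy_convergent_iff convergent_def)
  then obtain l where l: "\<And>n. (\<lambda>m. coord (X m) n) \<longlonglongrightarrow> l n" by metis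
  have tail: "(\<Sum>n\<in>F. (cmod (coord (X m) n - l n))\<^sup>2) \<le> e\<^sup>2"
    if "finite F" and M: "\<And>m'. m' \<ge> M \<Longrightarrow> norm (X m - X m') \<le> e" for F e m M
  proof (rule LIMSEQ_le_const2)
    show "(\<lambda>m'. \<Sum>n\<in>F. (cmod (coord (X m) n - coord (X m') n))\<^sup>2)
            \<longlonglongrightarrow> (\<Sum>n\<in>F. (cmod (coord (X m) n - l n))\<^sup>2)"
      by (intro tendsto_intros l)
    show "\<exists>N. \<forall>m'\<ge>N. (\<Sum>n\<in>F. (cmod (coord (X m) n - coord (X m') n))\<^sup>2) \<le> e\<^sup>2"
    proof (intro exI allI impI)
      fix m' assume "m' \<ge> M"
      have "(\<Sum>n\<in>F. (cmod (coord (X m) n - coord (X m') n))\<^sup>2) \<le> (norm (X m - X m'))\<^sup>2"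
        using sum_coord_le_norm_sq[OF that(1), of "X m - X m'"] by simp
      also have "\<dots> \<le> e\<^sup>2" using M[OF \<open>m' \<ge> M\<close>] by (intro power_mono) auto
      finally show "(\<Sum>n\<in>F. (cmod (coord (X m) n - coord (X m') n))\<^sup>2) \<le> e\<^sup>2" .
    qed
  qed
  have diff: "(\<lambda>n. (cmod (coord (X m) n - l n))\<^sup>2) summable_on UNIV \<and>
      (\<Sum>\<^sub>\<infinity>n. (cmod (coord (X m) n - l n))\<^sup>2) \<le> e\<^sup>2"
    if M: "\<And>m'. m' \<ge> M \<Longrightarrow> norm (X m - X m') \<le> e" for e m M
  proof
    show s: "(\<lambda>n. (cmod (coord (X m) n - l n))\<^sup>2) summable_on UNIV"
      by (rule nonneg_bdd_above_summable_on) (use tail[OF _ M] in \<open>auto intro!: bdd_aboveI2\<close>)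
    show "(\<Sum>\<^sub>\<infinity>n. (cmod (coord (X m) n - l n))\<^sup>2) \<le> e\<^sup>2"
      by (rule infsum_le_finite_sums[OF s]) (use tail[OF _ M] in auto)
  qed
  have M: "\<exists>M. \<forall>m\<ge>M. \<forall>m'\<ge>M. norm (X m - X m') \<le> e" if "e > 0" for e
    using metric_CauchyD[OF X that] by (metis dist_norm less_imp_le)
  obtain M1 where "\<And>m'. m' \<ge> M1 \<Longrightarrow> norm (X M1 - X m') \<le> 1"
    using M[of 1] by auto
  from diff[OF this] have "(\<lambda>n. (cmod (coord (X M1) n - l n))\<^sup>2) summable_on UNIV" by simp
  then have "(\<lambda>n. (cmod (l n - coord (X M1) n))\<^sup>2) summable_on UNIV" by (simp add: norm_minus_commute)
  from square_summable_add[OF this coord_summable[of "X M1"]]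
  have L: "coord (Abs_ell2 l) = l" by (simp add: Abs_ell2_inverse)
  have "X \<longlonglongrightarrow> Abs_ell2 l"
  proof (rule metric_LIMSEQ_I)
    fix e :: real assume "e > 0"
    then obtain N where N: "\<And>m m'. m \<ge> N \<Longrightarrow> m' \<ge> N \<Longrightarrow> norm (X m - X m') \<le> e / 2"
      using M[of "e / 2"] by auto
    show "\<exists>N. \<forall>m\<ge>N. dist (X m) (Abs_ell2 l) < e"
    proof (intro exI allI impI)
      fix m assume "m \<ge> N"
      have "(norm (X m - Abs_ell2 l))\<^sup>2 \<le> (e / 2)\<^sup>2"
        using diff[of N m "e / 2"] N[OF \<open>m \<ge> N\<close>] by (simp add: norm_ell2_sq L)
      then have "norm (X m - Abs_ell2 l) \<le> e / 2"
        using \<open>e > 0\<close> by (auto intro: power2_le_imp_le)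
      then show "dist (X m) (Abs_ell2 l) < e" using \<open>e > 0\<close> by (simp add: dist_norm)
    qed
  qed
  then show "convergent X" by (auto simp: convergent_def)
qed


section \<open>Spectrum and pseudospectrum of operators on \<open>\<ell>\<^sup>2(\<int>)\<close>\<close>

definition bounded_clinear :: "(ell2 \<Rightarrow> ell2) \<Rightarrow> bool"
  where "bounded_clinear A \<longleftrightarrow> bounded_linear A \<and> (\<forall>z u. A (z *\<^sub>C u) = z *\<^sub>C A u)"

definition resolvent_set :: "(ell2 \<Rightarrow> ell2) \<Rightarrow> complex set"
  where "resolvent_set A =
    {z. bij (\<lambda>u. z *\<^sub>C u - A u) \<and> bounded_clinear (inv (\<lambda>u. z *\<^sub>C u - A u))}"

definition resolvent :: "(ell2 \<Rightarrow> ell2) \<Rightarrow> complex \<Rightarrow> ell2 \<Rightarrow> ell2"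
  where "resolvent A z = inv (\<lambda>u. z *\<^sub>C u - A u)"

definition spectrum :: "(ell2 \<Rightarrow> ell2) \<Rightarrow> complex set"
  where "spectrum A = - resolvent_set A"

(* The case distinction implements the convention that the 0-pseudospectrum is the spectrum;
   it is needed because 1 / 0 = 0. *)
definition pseudospectrum :: "real \<Rightarrow> (ell2 \<Rightarrow> ell2) \<Rightarrow> complex set"
  where "pseudospectrum \<epsilon> A =
    (if 0 < \<epsilon> then spectrum A \<union> {z. z \<notin> spectrum A \<and> onorm (resolvent A z) \<ge> 1 / \<epsilon>}
     else spectrum A)"


section \<open>Periodic Jacobi operators\<close>

definition periodic :: "nat \<Rightarrow> (int \<Rightarrow> real) \<Rightarrow> bool"
  where "periodic p x \<longleftrightarrow> (\<forall>i. x (i + int p) = x i)"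

(* Meaningful whenever the coefficient sequences are bounded, in particular when they are
   periodic with positive period: see coord_jacobi and bounded_clinear_jacobi below. *)
definition jacobi :: "(int \<Rightarrow> real) \<Rightarrow> (int \<Rightarrow> real) \<Rightarrow> (int \<Rightarrow> real) \<Rightarrow> ell2 \<Rightarrow> ell2"
  where "jacobi a b c u = Abs_ell2 (\<lambda>n.
    complex_of_real (c (n - 1)) * coord u (n - 1) + complex_of_real (a n) * coord u n
      + complex_of_real (b n) * coord u (n + 1))"

(* The set is finite for periodic sequences, so the maximum is attained. *)
definition oscillation :: "(int \<Rightarrow> real) \<Rightarrow> real"
  where "oscillation a = Max {\<bar>a (int i) - a (int j)\<bar> |i j :: nat. True}"

lemma periodic_range:
  assumes "periodic p x" "p > 0"
  shows "range x = x ` {0..<int p}"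
proof -
  have nat: "x (i + int p * int k) = x i" for i k
  proof (induction k)
    case (Suc k)
    have "x (i + int p * int (Suc k)) = x ((i + int p * int k) + int p)" by (simp add: algebra_simps)
    also have "\<dots> = x (i + int p * int k)" using assms(1) unfolding periodic_def by blast
    finally show ?case using Suc by simp
  qed simp
  have "x i = x (i mod int p)" for i
  proof (cases "i div int p \<ge> 0")
    case True
    then show ?thesis using nat[of "i mod int p" "nat (i div int p)"] by simp
  next
    case False
    have "i + int p * (- (i div int p)) = i mod int p" by (simp add: minus_mult_div_eq_mod)
    then show ?thesis using False nat[of i "nat (- (i div int p))"] by simp
  qed
  moreover have "i mod int p \<in> {0..<int p}" for i using assms(2) by simp
  ultimately show ?thesis by blast
qed

lemma periodic_finite_range: "periodic p x \<Longrightarrow> p > 0 \<Longrightarrow> finite (range x)"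
  using periodic_range[of p x] by simp

lemma periodic_bounded:
  assumes "periodic p x" "p > 0"
  obtains K where "\<And>n. \<bar>x n\<bar> \<le> K"
  using periodic_finite_range[OF assms] finite_imp_bounded bounded_iff
  by (metis rangeI real_norm_def)

lemma finite_oscillation:
  assumes "periodic p a" "p > 0"
  shows "finite {\<bar>a (int i) - a (int j)\<bar> |i j :: nat. True}"
proof (rule finite_subset)
  show "{\<bar>a (int i) - a (int j)\<bar> |i j :: nat. True} \<subseteq> (\<lambda>(s, t). \<bar>s - t\<bar>) ` (range a \<times> range a)"
    by auto
  show "finite ((\<lambda>(s, t). \<bar>s - t\<bar>) ` (range a \<times> range a))"
    using periodic_finite_range[OF assms] by simp
qed

lemma square_summable_jacobi:
  assumes K: "\<And>n. \<bar>a n\<bar> \<le> Ka" "\<And>n. \<bar>b n\<bar> \<le> Kb" "\<And>n. \<bar>c n\<bar> \<le> Kc"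
  shows "(\<lambda>n. (cmod (complex_of_real (c (n - 1)) * coord u (n - 1)
      + complex_of_real (a n) * coord u n + complex_of_real (b n) * coord u (n + 1)))\<^sup>2) summable_on UNIV"
  using square_summable_shift[OF coord_summable, of u "-1"]
        square_summable_shift[OF coord_summable, of u 1]
  by (intro square_summable_add square_summable_bounded_mult[where K = Kc]
        square_summable_bounded_mult[where K = Ka] square_summable_bounded_mult[where K = Kb])
     (auto simp: K coord_summable)

context
  fixes p :: nat and a b c :: "int \<Rightarrow> real"
  assumes per: "periodic p a" "periodic p b" "periodic p c" and p: "p > 0"
begin

lemma coord_jacobi:
  "coord (jacobi a b c u) n = complex_of_real (c (n - 1)) * coord u (n - 1)
     + complex_of_real (a n) * coord u n + complex_of_real (b n) * coord u (n + 1)"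
proof -
  obtain Ka Kb Kc where "\<And>n. \<bar>a n\<bar> \<le> Ka" "\<And>n. \<bar>b n\<bar> \<le> Kb" "\<And>n. \<bar>c n\<bar> \<le> Kc"
    using per p by (metis periodic_bounded)
  from square_summable_jacobi[where u = u, of a, OF this]
  show ?thesis unfolding jacobi_def by (subst Abs_ell2_inverse) auto
qed

lemma bounded_clinear_jacobi: "bounded_clinear (jacobi a b c)"
proof -
  obtain Ka Kb Kc where K: "\<And>n. \<bar>a n\<bar> \<le> Ka" "\<And>n. \<bar>b n\<bar> \<le> Kb" "\<And>n. \<bar>c n\<bar> \<le> Kc"
    using per p by (metis periodic_bounded)
  have shift: "((\<lambda>n. (cmod (coord u (n + d)))\<^sup>2) has_sum (norm u)\<^sup>2) UNIV" for u :: ell2 and d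
  proof -
    have "bij (\<lambda>n::int. n + d)"
      by (rule bij_betwI[of _ _ _ "\<lambda>n. n - d"]) auto
    moreover have "((\<lambda>n. (cmod (coord u n))\<^sup>2) has_sum (norm u)\<^sup>2) UNIV"
      unfolding norm_ell2_sq by (rule has_sum_infsum[OF coord_summable])
    ultimately show ?thesis
      using has_sum_reindex_bij_betw[of "\<lambda>n. n + d" UNIV UNIV "\<lambda>n. (cmod (coord u n))\<^sup>2"] by simp
  qed
  have "(norm (jacobi a b c u))\<^sup>2 \<le> (3 * (Kc\<^sup>2 + Ka\<^sup>2 + Kb\<^sup>2)) * (norm u)\<^sup>2" for u
  proof -
    have S: "((\<lambda>n. 3 * (Kc\<^sup>2 * (cmod (coord u (n - 1)))\<^sup>2 + Ka\<^sup>2 * (cmod (coord u n))\<^sup>2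
        + Kb\<^sup>2 * (cmod (coord u (n + 1)))\<^sup>2)) has_sum
        3 * (Kc\<^sup>2 * (norm u)\<^sup>2 + Ka\<^sup>2 * (norm u)\<^sup>2 + Kb\<^sup>2 * (norm u)\<^sup>2)) UNIV"
      using shift[of u "-1"] shift[of u 0] shift[of u 1]
      by (intro has_sum_cmult_right has_sum_add) simp_all
    have le: "(cmod (coord (jacobi a b c u) n))\<^sup>2 \<le> 3 * (Kc\<^sup>2 * (cmod (coord u (n - 1)))\<^sup>2
        + Ka\<^sup>2 * (cmod (coord u n))\<^sup>2 + Kb\<^sup>2 * (cmod (coord u (n + 1)))\<^sup>2)" for n
    proof -
      have sq: "(x + y + z)\<^sup>2 \<le> 3 * (x\<^sup>2 + y\<^sup>2 + z\<^sup>2)" for x y z :: real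
        using sum_squares_bound[of x y] sum_squares_bound[of x z] sum_squares_bound[of y z]
        by (simp add: power2_eq_square algebra_simps)
      let ?x = "\<bar>c (n - 1)\<bar> * cmod (coord u (n - 1))" and ?y = "\<bar>a n\<bar> * cmod (coord u n)"
        and ?z = "\<bar>b n\<bar> * cmod (coord u (n + 1))"
      have "cmod (coord (jacobi a b c u) n) \<le> ?x + ?y + ?z"
        unfolding coord_jacobi
        by (intro norm_triangle_le add_mono) (auto simp: norm_mult)
      then have "(cmod (coord (jacobi a b c u) n))\<^sup>2 \<le> (?x + ?y + ?z)\<^sup>2"
        by (intro power_mono) auto
      also have "\<dots> \<le> 3 * (?x\<^sup>2 + ?y\<^sup>2 + ?z\<^sup>2)" by (rule sq)
      also have "\<dots> \<le> 3 * (Kc\<^sup>2 * (cmod (coord u (n - 1)))\<^sup>2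
        + Ka\<^sup>2 * (cmod (coord u n))\<^sup>2 + Kb\<^sup>2 * (cmod (coord u (n + 1)))\<^sup>2)"
        unfolding power_mult_distrib
        by (intro mult_left_mono add_mono mult_right_mono power_mono K) auto
      finally show ?thesis .
    qed
    have "(norm (jacobi a b c u))\<^sup>2 \<le> 3 * (Kc\<^sup>2 * (norm u)\<^sup>2 + Ka\<^sup>2 * (norm u)\<^sup>2 + Kb\<^sup>2 * (norm u)\<^sup>2)"
      unfolding norm_ell2_sq[of "jacobi a b c u"]
      by (rule has_sum_mono[OF has_sum_infsum[OF coord_summable] S le])
    then show ?thesis by (simp add: algebra_simps)
  qed
  then have "norm (jacobi a b c u) \<le> norm u * sqrt (3 * (Kc\<^sup>2 + Ka\<^sup>2 + Kb\<^sup>2))" for u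
    using real_le_rsqrt[of "norm (jacobi a b c u)" "(3 * (Kc\<^sup>2 + Ka\<^sup>2 + Kb\<^sup>2)) * (norm u)\<^sup>2"]
    by (simp only: real_sqrt_mult real_sqrt_abs abs_norm_cancel mult.commute[of "norm u"])
  then have "bounded_linear (jacobi a b c)"
    by (intro bounded_linear_intro[where K = "sqrt (3 * (Kc\<^sup>2 + Ka\<^sup>2 + Kb\<^sup>2))"] ell2_eqI)
       (simp_all add: coord_jacobi algebra_simps)
  moreover have "jacobi a b c (z *\<^sub>C u) = z *\<^sub>C jacobi a b c u" for z u
    by (rule ell2_eqI) (simp add: coord_jacobi algebra_simps)
  ultimately show ?thesis unfolding bounded_clinear_def by blast
qed

end

end

theory Submission
  imports Defs
begin

text \<open>
  Put \<open>d = (b + c) / 2\<close>. The symmetric operator \<open>S\<close> with diagonal \<open>a\<close> and off-diagonal \<open>d\<close> differs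
  from \<open>J\<close> by an operator of norm at most \<open>|k|\<close>, so the \<open>\<epsilon>\<close>-pseudospectrum of \<open>J\<close> contains the
  extreme points of the spectrum of \<open>S\<close> and lies within \<open>\<epsilon> + |k|\<close> of that spectrum.

  Deleting the sites \<open>n + p\<int>\<close> decouples \<open>S\<close> into copies of a \<open>(p - 1) \<times> (p - 1)\<close> Dirichlet matrix
  with ordered eigenvalues \<open>\<mu>\<^sub>1(n) \<le> \<dots> \<le> \<mu>\<^sub>p\<^sub>-\<^sub>1(n)\<close> whose sum is \<open>(\<Sum>i. a i) - a n\<close>. If
  \<open>\<mu>\<^sub>j(n) < \<mu>\<^sub>j(m)\<close>, then \<open>S\<close> has no spectrum strictly between these two numbers, so connectedness
  gives \<open>\<mu>\<^sub>j(m) - \<mu>\<^sub>j(n) \<le> 2 (\<epsilon> + |k|)\<close>; summing over \<open>j\<close> bounds \<open>a n - a m\<close>.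

  The absence of spectrum is proved on a cyclic chain of \<open>N\<close> periods. The \<open>j\<close> lowest Dirichlet
  eigenvectors for \<open>n\<close> and the \<open>p - j\<close> highest ones for \<open>m\<close>, taken in each period, span the whole
  chain by a dimension count. Writing \<open>u = f + g\<close> accordingly and testing \<open>(S - x) u\<close> against
  \<open>g - f\<close>, where \<open>x\<close> is the midpoint and \<open>h\<close> half the distance, the cross terms cancel and
  \<open>\<parallel>(S - x) u\<parallel> \<ge> h \<parallel>u\<parallel>\<close> follows.
\<close>

subsection \<open>Linear systems and eigenbases of real symmetric matrices\<close>

text \<open>Gaussian elimination, by induction on the equations: equation \<open>j\<close> is solved
  for an unknown \<open>f0\<close> with nonzero coefficient, which is then substituted into the
  others.\<close>

lemma homogeneous_system_solution:
  fixes G :: "'i \<Rightarrow> 'f \<Rightarrow> real"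
  assumes "finite I" "finite F" "card I < card F"
  shows "\<exists>w. (\<exists>f\<in>F. w f \<noteq> 0) \<and> (\<forall>i\<in>I. (\<Sum>f\<in>F. G i f * w f) = 0)"
  using assms
proof (induction I arbitrary: F G rule: finite_induct)
  case empty
  then have "F \<noteq> {}" by auto
  then show ?case by (intro exI[of _ "\<lambda>_. 1"]) auto
next
  case (insert j I)
  show ?case
  proof (cases "\<forall>f\<in>F. G j f = 0")
    case True
    have "card I < card F" using insert by simp
    from insert.IH[OF insert.prems(1) this, of G] obtain w
      where "\<exists>f\<in>F. w f \<noteq> 0" "\<forall>i\<in>I. (\<Sum>f\<in>F. G i f * w f) = 0" by (elim exE conjE) (rule that)
    then show ?thesis using True by (intro exI[of _ w]) simp
  next
    case False
    then obtain f0 where f0: "f0 \<in> F" "G j f0 \<noteq> 0" by auto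
    define F' where "F' = F - {f0}"
    have F: "F = insert f0 F'" "f0 \<notin> F'" "finite F'" using f0 insert.prems by (auto simp: F'_def)
    have "card I < card F'" using insert F by simp
    from insert.IH[OF F(3) this, of "\<lambda>i f. G i f - G i f0 * (G j f / G j f0)"]
    obtain w where w: "\<exists>f\<in>F'. w f \<noteq> 0"
      "\<forall>i\<in>I. (\<Sum>f\<in>F'. (G i f - G i f0 * (G j f / G j f0)) * w f) = 0" by (elim exE conjE) (rule that)
    \<comment> \<open>The value that equation \<open>j\<close> forces on the eliminated unknown
      \<open>f0\<close>.\<close>
    define c where "c = - (\<Sum>f\<in>F'. (G j f / G j f0) * w f)"
    define w' where "w' = w(f0 := c)"
    have eq: "(\<Sum>f\<in>F. G i f * w' f) = G i f0 * c + (\<Sum>f\<in>F'. G i f * w f)" for i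
    proof -
      have "(\<Sum>f\<in>F'. G i f * w' f) = (\<Sum>f\<in>F'. G i f * w f)"
        using F(2) by (intro sum.cong) (auto simp: w'_def)
      then show ?thesis unfolding F(1) using F by (simp add: w'_def)
    qed
    have "(\<Sum>f\<in>F. G j f * w' f) = 0"
      unfolding eq c_def using f0(2) by (simp add: sum_distrib_left)
    moreover have "(\<Sum>f\<in>F. G i f * w' f) = 0" if "i \<in> I" for i
      unfolding eq c_def using w(2)[rule_format, OF that]
      by (simp add: sum_distrib_left sum_subtractf algebra_simps)
    moreover have "\<exists>f\<in>F. w' f \<noteq> 0" using w(1) F by (auto simp: w'_def)
    ultimately show ?thesis by (intro exI[of _ w']) auto
  qed
qed

text \<open>Uniqueness gives existence for a square system. The right-hand side becomes an extra
  column \<open>None\<close>, so the enlarged homogeneous system has more unknowns than equations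
  and a nonzero solution; uniqueness makes its \<open>None\<close> entry nonzero, and dividing by
  that entry solves the original system.\<close>

lemma square_system_solution:
  fixes G :: "'i \<Rightarrow> 'f \<Rightarrow> real"
  assumes fin: "finite I" "finite F" "card I = card F"
    and inj: "\<And>w i. \<forall>f\<in>F. (\<Sum>i\<in>I. w i * G i f) = 0 \<Longrightarrow> i \<in> I \<Longrightarrow> w i = 0"
  shows "\<exists>w. \<forall>f\<in>F. (\<Sum>i\<in>I. w i * G i f) = u f"
proof -
  define H where "H f x = (case x of None \<Rightarrow> - u f | Some i \<Rightarrow> G i f)" for f x
  have sum: "(\<Sum>x\<in>insert None (Some ` I). H f x * w x) = (\<Sum>i\<in>I. w (Some i) * G i f) - u f * w None"
    for f w
    using fin by (simp add: H_def sum.reindex mult.commute)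
  have "card F < card (insert None (Some ` I))" using fin by (simp add: card_image)
  from homogeneous_system_solution[OF fin(2) _ this, of H] fin(1)
  obtain w where w1: "\<exists>x\<in>insert None (Some ` I). w x \<noteq> 0"
    and "\<forall>f\<in>F. (\<Sum>x\<in>insert None (Some ` I). H f x * w x) = 0"
    by auto
  then have w2: "(\<Sum>i\<in>I. w (Some i) * G i f) = u f * w None" if "f \<in> F" for f
    using that by (simp add: sum)
  have "w None \<noteq> 0"
  proof
    assume "w None = 0"
    then have "w (Some i) = 0" if "i \<in> I" for i
      using inj[of "\<lambda>i. w (Some i)", OF _ that] w2 by simp
    with w1 \<open>w None = 0\<close> show False by auto
  qed
  then have "(\<Sum>i\<in>I. w (Some i) / w None * G i f) = u f" if "f \<in> F" for f
    using w2[OF that] by (simp add: sum_divide_distrib[symmetric])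
  then show ?thesis by (intro exI[of _ "\<lambda>i. w (Some i) / w None"]) blast
qed

section \<open>Ordered eigenbases by constrained minimization\<close>

definition dot :: "nat \<Rightarrow> (nat \<Rightarrow> real) \<Rightarrow> (nat \<Rightarrow> real) \<Rightarrow> real"
  where "dot q f g = (\<Sum>i<q. f i * g i)"

definition mv :: "nat \<Rightarrow> (nat \<Rightarrow> nat \<Rightarrow> real) \<Rightarrow> (nat \<Rightarrow> real) \<Rightarrow> nat \<Rightarrow> real"
  where "mv q M f i = (\<Sum>k<q. M i k * f k)"

lemma dot_commute: "dot q f g = dot q g f"
  by (simp add: dot_def mult.commute)

lemma dot_add: "dot q (\<lambda>i. f i + r * g i) h = dot q f h + r * dot q g h"
  by (simp add: dot_def algebra_simps sum.distrib sum_distrib_left)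

lemma dot_add_right: "dot q h (\<lambda>i. f i + r * g i) = dot q h f + r * dot q h g"
  by (simp add: dot_def algebra_simps sum.distrib sum_distrib_left)

lemma mv_add: "mv q M (\<lambda>i. f i + r * g i) = (\<lambda>i. mv q M f i + r * mv q M g i)"
  by (simp add: mv_def fun_eq_iff algebra_simps sum.distrib sum_distrib_left)

lemma dot_nonneg: "0 \<le> dot q f f"
  by (simp add: dot_def sum_nonneg)

lemma dot_eq_0_iff: "dot q f f = 0 \<longleftrightarrow> (\<forall>i<q. f i = 0)"
  unfolding dot_def by (subst sum_nonneg_eq_0_iff) auto

lemma dot_mv_commute:
  assumes "\<And>i k. M i k = M k i"
  shows "dot q (mv q M f) g = dot q f (mv q M g)"
proof -
  have "dot q (mv q M f) g = (\<Sum>i<q. \<Sum>k<q. M i k * f k * g i)"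
    by (simp add: dot_def mv_def sum_distrib_right)
  also have "\<dots> = (\<Sum>k<q. \<Sum>i<q. M i k * f k * g i)" by (rule sum.swap)
  also have "\<dots> = dot q f (mv q M g)"
    unfolding dot_def mv_def sum_distrib_left using assms by (intro sum.cong) (auto simp: mult_ac)
  finally show ?thesis .
qed

text \<open>The Rayleigh quotient attains its minimum on the orthogonal complement of
  \<open>m\<close> vectors: the unit sphere there is compact and, as \<open>m < q\<close>,
  nonempty.\<close>

lemma constrained_minimizer:
  assumes "m < q"
  shows "\<exists>f. dot q f f = 1 \<and> (\<forall>s<m. dot q f (v s) = 0) \<and>
    (\<forall>g. (\<forall>s<m. dot q g (v s) = 0) \<longrightarrow> dot q (mv q M f) f * dot q g g \<le> dot q (mv q M g) g)"
proof -
  \<comment> \<open>Vectors are functions on all of \<open>nat\<close>; pinning the entries from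
    \<open>q\<close> on to 0 makes \<open>B\<close> a product of compact sets.\<close>
  define B where "B = PiE UNIV (\<lambda>i::nat. if i < q then {-1..1::real} else {0})"
  define K where "K = B \<inter> {f. dot q f f = 1} \<inter> (\<Inter>s\<in>{..<m}. {f. dot q f (v s) = 0})"
  have cont: "continuous_on UNIV (\<lambda>f. dot q (F f) (G f))"
    if "\<And>i. continuous_on UNIV (\<lambda>f. F f i)" "\<And>i. continuous_on UNIV (\<lambda>f. G f i)"
    for F G :: "(nat \<Rightarrow> real) \<Rightarrow> nat \<Rightarrow> real"
    unfolding dot_def by (intro continuous_intros that)
  have coord: "continuous_on UNIV (\<lambda>f::nat \<Rightarrow> real. f i)" for i
    using continuous_on_product_then_coordinatewise[OF continuous_on_id] by simp
  have "compactin (product_topology (\<lambda>_. euclidean) UNIV) B" unfolding B_def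
    by (subst compactin_PiE) auto
  then have "compact B" by (simp add: euclidean_product_topology)
  moreover have "closed {f. dot q f g = r}" for g r
    by (intro closed_Collect_eq cont coord continuous_on_const)
  moreover have "closed {f. dot q f f = 1}"
    by (intro closed_Collect_eq cont coord continuous_on_const)
  ultimately have "compact K"
    unfolding K_def by (intro compact_Int_closed closed_INT) auto
  \<comment> \<open>By homogeneity it is enough to minimize over \<open>K\<close>: below
    \<open>q\<close>, each admissible vector of nonzero norm is a positive multiple of a member of
    \<open>K\<close>.\<close>
  have norm: "\<exists>h\<in>K. \<exists>c>0. dot q g g = c\<^sup>2 \<and> (\<forall>i<q. g i = c * h i)"
    if g: "\<forall>s<m. dot q g (v s) = 0" "dot q g g \<noteq> 0" for g
  proof -
    define c where "c = sqrt (dot q g g)"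
    have c: "c > 0" "dot q g g = c\<^sup>2" using g(2) dot_nonneg[of q g] by (auto simp: c_def)
    define h where "h i = (if i < q then g i / c else 0)" for i
    have h: "g i = c * h i" if "i < q" for i using that c by (simp add: h_def)
    have dh: "dot q h k = dot q g k / c" for k
      by (simp add: dot_def h_def sum_divide_distrib)
    have hh: "dot q h h = 1"
      using c by (simp add: dh dot_commute[of q g h] power2_eq_square)
    have "\<bar>h i\<bar> \<le> 1" if "i < q" for i
    proof -
      have "(h i)\<^sup>2 \<le> dot q h h" unfolding dot_def power2_eq_square
        by (rule member_le_sum[of i]) (use that in auto)
      then show ?thesis using hh by (simp add: abs_square_le_1)
    qed
    then have "- 1 \<le> h i \<and> h i \<le> 1" if "i < q" for i
      using that by (metis abs_le_iff minus_le_iff)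
    then have "h \<in> B" by (auto simp: B_def h_def)
    then have "h \<in> K" using hh g(1) by (auto simp: K_def dh)
    with c h show ?thesis by blast
  qed
  obtain w where w: "\<exists>i\<in>{..<q}. w i \<noteq> 0" "\<And>s. s < m \<Longrightarrow> (\<Sum>i<q. v s i * w i) = 0"
    using homogeneous_system_solution[of "{..<m}" "{..<q}" v] assms by auto
  then have "dot q w w \<noteq> 0" "\<forall>s<m. dot q w (v s) = 0"
    by (auto simp: dot_eq_0_iff) (simp add: dot_def mult.commute)
  from norm[OF this(2,1)] have "K \<noteq> {}" by auto
  have "continuous_on K (\<lambda>f. dot q (mv q M f) f)"
    by (rule continuous_on_subset[OF cont]) (auto simp: mv_def intro!: continuous_intros)
  from continuous_attains_inf[OF \<open>compact K\<close> \<open>K \<noteq> {}\<close> this]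
  obtain f where f: "f \<in> K" "\<And>h. h \<in> K \<Longrightarrow> dot q (mv q M f) f \<le> dot q (mv q M h) h" by blast
  show ?thesis
  proof (intro exI[of _ f] conjI allI impI)
    fix g assume g: "\<forall>s<m. dot q g (v s) = 0"
    show "dot q (mv q M f) f * dot q g g \<le> dot q (mv q M g) g"
    proof (cases "dot q g g = 0")
      case True
      then show ?thesis by (simp add: dot_eq_0_iff) (simp add: dot_def)
    next
      case False
      from norm[OF g this] obtain h c where h: "h \<in> K" "c > 0" "dot q g g = c\<^sup>2" "\<And>i. i < q \<Longrightarrow> g i = c * h i"
        by blast
      have "dot q (mv q M g) g = c\<^sup>2 * dot q (mv q M h) h"
        unfolding dot_def mv_def using h(4)
        by (simp add: sum_distrib_left sum_distrib_right power2_eq_square mult_ac)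
      then show ?thesis using f(2)[OF h(1)] h(2,3) by (simp add: mult.commute mult_left_mono)
    qed
  qed (use f(1) in \<open>auto simp: K_def\<close>)
qed

text \<open>The first-order condition at a minimum. The test value
  \<open>t = - B / (\<bar>C\<bar> + 1)\<close> would make the quadratic negative if \<open>B\<close>
  were nonzero.\<close>

lemma linear_coefficient_zero:
  fixes B C :: real
  assumes "\<And>t. 0 \<le> 2 * t * B + t\<^sup>2 * C"
  shows "B = 0"
proof -
  have "0 \<le> 2 * (- B / (\<bar>C\<bar> + 1)) * B + (- B / (\<bar>C\<bar> + 1))\<^sup>2 * C" by (rule assms)
  also have "\<dots> \<le> 2 * (- B / (\<bar>C\<bar> + 1)) * B + (- B / (\<bar>C\<bar> + 1))\<^sup>2 * (\<bar>C\<bar> + 1)"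
    by (intro add_left_mono mult_left_mono) auto
  also have "\<dots> = - (B\<^sup>2 / (\<bar>C\<bar> + 1))"
  proof -
    have "\<bar>C\<bar> + 1 \<noteq> 0" by linarith
    then show ?thesis by (simp add: power2_eq_square)
  qed
  finally have "B\<^sup>2 / (\<bar>C\<bar> + 1) \<le> 0" by simp
  moreover have "\<bar>C\<bar> + 1 > 0" by linarith
  ultimately have "B\<^sup>2 \<le> 0" by (simp add: pos_divide_le_eq)
  then show ?thesis by simp
qed

text \<open>Each new vector minimizes the Rayleigh quotient on the orthogonal complement of the
  previous ones. The minimality clause is carried along because it later orders the
  eigenvalues.\<close>

lemma partial_eigenbasis:
  assumes sym: "\<And>i k. M i k = M k i" and "m \<le> q"
  shows "\<exists>v \<mu>. (\<forall>s<m. \<forall>t<m. dot q (v s) (v t) = (if s = t then 1 else 0)) \<and>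
    (\<forall>s<m. \<forall>i<q. mv q M (v s) i = \<mu> s * v s i) \<and>
    (\<forall>s<m. \<forall>g. (\<forall>t<s. dot q g (v t) = 0) \<longrightarrow> \<mu> s * dot q g g \<le> dot q (mv q M g) g)"
  using assms(2)
proof (induction m)
  case 0
  then show ?case by simp
next
  case (Suc m)
  then obtain v \<mu> where
    on: "\<And>s t. s < m \<Longrightarrow> t < m \<Longrightarrow> dot q (v s) (v t) = (if s = t then 1 else 0)" and
    ev: "\<And>s i. s < m \<Longrightarrow> i < q \<Longrightarrow> mv q M (v s) i = \<mu> s * v s i" and
    mn: "\<And>s g. s < m \<Longrightarrow> \<forall>t<s. dot q g (v t) = 0 \<Longrightarrow> \<mu> s * dot q g g \<le> dot q (mv q M g) g"
    by (metis Suc_leD)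
  obtain f where f: "dot q f f = 1" "\<And>s. s < m \<Longrightarrow> dot q f (v s) = 0"
    and min: "\<And>g. \<forall>s<m. dot q g (v s) = 0 \<Longrightarrow> dot q (mv q M f) f * dot q g g \<le> dot q (mv q M g) g"
    using constrained_minimizer[of m q v M] Suc.prems by (auto simp: Suc_le_eq)
  define l where "l = dot q (mv q M f) f"
  \<comment> \<open>The residual of the eigenvalue equation. It is orthogonal to the earlier
    vectors, so \<open>f + t h\<close> stays admissible; the first-order term of the variation is
    \<open>2 t\<close> times \<open>dot q h h\<close>, which must therefore vanish.\<close>
  define h where "h = (\<lambda>i. mv q M f i + (- l) * f i)"
  have hv: "dot q h (v s) = 0" if "s < m" for s
  proof -
    have "dot q (mv q M f) (v s) = dot q f (mv q M (v s))" by (rule dot_mv_commute[of M, OF sym])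
    also have "\<dots> = \<mu> s * dot q f (v s)"
      unfolding dot_def sum_distrib_left using ev[OF that] by (intro sum.cong) auto
    finally show ?thesis unfolding h_def dot_add using f(2)[OF that] by simp
  qed
  have "dot q h h = 0"
  proof (rule linear_coefficient_zero)
    fix t
    let ?g = "\<lambda>i. f i + t * h i"
    have min_g: "l * dot q ?g ?g \<le> dot q (mv q M ?g) ?g"
      unfolding l_def by (rule min) (use f(2) hv in \<open>simp add: dot_add\<close>)
    have gg: "dot q ?g ?g = 1 + 2 * t * dot q f h + t\<^sup>2 * dot q h h"
      using f(1) dot_commute[of q h f]
      by (simp add: dot_add dot_add_right algebra_simps power2_eq_square)
    have Mgg: "dot q (mv q M ?g) ?g = l + 2 * t * dot q (mv q M f) h + t\<^sup>2 * dot q (mv q M h) h"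
      using dot_mv_commute[of M, OF sym, of q h f] dot_commute[of q h "mv q M f"]
      by (simp add: mv_add dot_add dot_add_right l_def algebra_simps power2_eq_square)
    have hh: "dot q h h = dot q (mv q M f) h - l * dot q f h"
      using dot_add[of q "mv q M f" "- l" f h] unfolding h_def[symmetric] by simp
    have "2 * t * dot q h h + t\<^sup>2 * (dot q (mv q M h) h - l * dot q h h) =
        (l + 2 * t * dot q (mv q M f) h + t\<^sup>2 * dot q (mv q M h) h)
          - l * (1 + 2 * t * dot q f h + t\<^sup>2 * dot q h h)"
      by (subst (1) hh) (simp only: algebra_simps)
    also have "\<dots> \<ge> 0" using min_g unfolding gg Mgg by simp
    finally show "0 \<le> 2 * t * dot q h h + t\<^sup>2 * (dot q (mv q M h) h - l * dot q h h)" .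
  qed
  then have fe: "mv q M f i = l * f i" if "i < q" for i
    using that by (simp add: dot_eq_0_iff h_def)
  show ?case
  proof (intro exI[of _ "v(m := f)"] exI[of _ "\<mu>(m := l)"] conjI allI impI)
    fix s t assume "s < Suc m" "t < Suc m"
    then show "dot q ((v(m := f)) s) ((v(m := f)) t) = (if s = t then 1 else 0)"
      using on f f(2)[unfolded dot_commute[of q f]] by (auto simp: less_Suc_eq)
  next
    fix s i assume "s < Suc m" "i < q"
    then show "mv q M ((v(m := f)) s) i = (\<mu>(m := l)) s * (v(m := f)) s i"
      using ev fe by (auto simp: less_Suc_eq)
  next
    fix s g assume "s < Suc m" "\<forall>t<s. dot q g ((v(m := f)) t) = 0"
    then show "(\<mu>(m := l)) s * dot q g g \<le> dot q (mv q M g) g"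
      using mn[of s g] min[of g] by (auto simp: less_Suc_eq l_def)
  qed
qed

definition eigenbasis :: "nat \<Rightarrow> (nat \<Rightarrow> nat \<Rightarrow> real) \<Rightarrow> (nat \<Rightarrow> nat \<Rightarrow> real) \<Rightarrow> (nat \<Rightarrow> real) \<Rightarrow> bool"
  where "eigenbasis q M v \<mu> \<longleftrightarrow>
    (\<forall>s<q. \<forall>t<q. dot q (v s) (v t) = (if s = t then 1 else 0)) \<and>
    (\<forall>s<q. \<forall>i<q. mv q M (v s) i = \<mu> s * v s i) \<and>
    (\<forall>s t. s \<le> t \<longrightarrow> t < q \<longrightarrow> \<mu> s \<le> \<mu> t)"

text \<open>A later eigenvector competes in the minimization that defines an earlier eigenvalue,
  which gives the ordering. The trace formula comes from the completeness relation of the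
  orthonormal basis.\<close>

theorem ordered_eigenbasis:
  assumes sym: "\<And>i k. M i k = M k i"
  obtains v \<mu> where "eigenbasis q M v \<mu>" "(\<Sum>s<q. \<mu> s) = (\<Sum>i<q. M i i)"
proof -
  obtain v \<mu> where vm: "(\<forall>s<q. \<forall>t<q. dot q (v s) (v t) = (if s = t then 1 else 0)) \<and>
    (\<forall>s<q. \<forall>i<q. mv q M (v s) i = \<mu> s * v s i) \<and>
    (\<forall>s<q. \<forall>g. (\<forall>t<s. dot q g (v t) = 0) \<longrightarrow> \<mu> s * dot q g g \<le> dot q (mv q M g) g)"
    using partial_eigenbasis[of M q q, OF sym order_refl] by (elim exE) (rule that)
  note on = vm[THEN conjunct1, rule_format]
    and ev = vm[THEN conjunct2, THEN conjunct1, rule_format]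
    and mn = vm[THEN conjunct2, THEN conjunct2, rule_format]
  have quad: "dot q (mv q M (v s)) (v s) = \<mu> s" if "s < q" for s
  proof -
    have "dot q (mv q M (v s)) (v s) = \<mu> s * dot q (v s) (v s)"
      unfolding dot_def sum_distrib_left using ev[OF that] by (intro sum.cong) auto
    then show ?thesis using on that by simp
  qed
  have mono: "\<mu> s \<le> \<mu> t" if "s \<le> t" "t < q" for s t
    using mn[of s "v t"] that on[of t] quad[of t] by simp
  \<comment> \<open>With \<open>u = 0\<close> this supplies the independence for
    \<open>square_system_solution\<close>; with \<open>u\<close> a unit vector it identifies the
    coefficients in \<open>complete\<close>.\<close>
  have coef: "w t = dot q u (v t)"
    if "\<forall>i\<in>{..<q}. (\<Sum>s\<in>{..<q}. w s * v s i) = u i" "t < q" for w u t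
  proof -
    have "dot q u (v t) = (\<Sum>i<q. (\<Sum>s<q. w s * v s i) * v t i)"
      unfolding dot_def using that(1) by (intro sum.cong) auto
    also have "\<dots> = (\<Sum>i<q. \<Sum>s<q. w s * (v s i * v t i))"
      by (simp add: sum_distrib_right mult.assoc)
    also have "\<dots> = (\<Sum>s<q. w s * dot q (v s) (v t))"
      unfolding dot_def sum_distrib_left by (rule sum.swap)
    also have "\<dots> = (\<Sum>s<q. if s = t then w s else 0)"
      by (intro sum.cong) (use on that in auto)
    finally show ?thesis using that(2) by simp
  qed
  have complete: "(\<Sum>s<q. v s k * v s i) = (if i = k then 1 else 0)" if "k < q" "i < q" for i k
  proof -
    have "\<exists>w. \<forall>i\<in>{..<q}. (\<Sum>s\<in>{..<q}. w s * v s i) = (if i = k then 1 else 0)"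
      by (rule square_system_solution) (use coef[of _ "\<lambda>_. 0"] in \<open>simp_all add: dot_def\<close>)
    then obtain w where w: "\<forall>i\<in>{..<q}. (\<Sum>s\<in>{..<q}. w s * v s i) = (if i = k then 1 else 0)" by blast
    have "w s = v s k" if "s < q" for s
      using coef[OF w that] \<open>k < q\<close> by (simp add: dot_def if_distrib[of "\<lambda>x. x * _"] cong: if_cong)
    then show ?thesis using w that by simp
  qed
  have "(\<Sum>s<q. \<mu> s) = (\<Sum>s<q. \<Sum>i<q. \<Sum>k<q. M i k * (v s k * v s i))"
  proof (intro sum.cong refl)
    fix s assume "s \<in> {..<q}"
    then have "\<mu> s = dot q (mv q M (v s)) (v s)" using quad by simp
    also have "\<dots> = (\<Sum>i<q. \<Sum>k<q. M i k * (v s k * v s i))"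
      by (simp add: dot_def mv_def sum_distrib_right mult.assoc)
    finally show "\<mu> s = (\<Sum>i<q. \<Sum>k<q. M i k * (v s k * v s i))" .
  qed
  also have "\<dots> = (\<Sum>i<q. \<Sum>s<q. \<Sum>k<q. M i k * (v s k * v s i))" by (rule sum.swap)
  also have "\<dots> = (\<Sum>i<q. \<Sum>k<q. \<Sum>s<q. M i k * (v s k * v s i))"
    by (intro sum.cong sum.swap refl)
  also have "\<dots> = (\<Sum>i<q. \<Sum>k<q. if k = i then M i k else 0)"
    unfolding sum_distrib_left[symmetric] using complete by (intro sum.cong) auto
  also have "\<dots> = (\<Sum>i<q. M i i)" by simp
  finally have trace: "(\<Sum>s<q. \<mu> s) = (\<Sum>i<q. M i i)" .
  have "eigenbasis q M v \<mu>" using vm mono unfolding eigenbasis_def by (intro conjI allI impI) auto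
  then show thesis using trace by (rule that)
qed

subsection \<open>Periodic tridiagonal operators on a cyclic chain\<close>

text \<open>Parseval on the span of the eigenvectors in \<open>S\<close>; \<open>bil\<close> is the
  polarized form that yields both identities.\<close>

lemma eigenbasis_energy:
  assumes eb: "eigenbasis q M v \<mu>" and S: "S \<subseteq> {..<q}" and g: "\<And>k. k < q \<Longrightarrow> g k = (\<Sum>s\<in>S. w s * v s k)"
  shows "dot q (mv q M g) g = (\<Sum>s\<in>S. \<mu> s * (w s)\<^sup>2)" and "dot q g g = (\<Sum>s\<in>S. (w s)\<^sup>2)"
proof -
  have fin: "finite S" using S finite_subset by blast
  have bil: "dot q (\<lambda>k. \<Sum>s\<in>S. c s * v s k) g = (\<Sum>s\<in>S. c s * w s)" for c
  proof -
    have "dot q (\<lambda>k. \<Sum>s\<in>S. c s * v s k) g = (\<Sum>i<q. \<Sum>s\<in>S. \<Sum>t\<in>S. c s * w t * (v s i * v t i))"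
      unfolding dot_def using g by (intro sum.cong) (auto simp: sum_product mult_ac)
    also have "\<dots> = (\<Sum>s\<in>S. \<Sum>i<q. \<Sum>t\<in>S. c s * w t * (v s i * v t i))" by (rule sum.swap)
    also have "\<dots> = (\<Sum>s\<in>S. \<Sum>t\<in>S. \<Sum>i<q. c s * w t * (v s i * v t i))"
      by (intro sum.cong sum.swap refl)
    also have "\<dots> = (\<Sum>s\<in>S. \<Sum>t\<in>S. c s * w t * dot q (v s) (v t))"
      by (simp add: dot_def sum_distrib_left)
    also have "\<dots> = (\<Sum>s\<in>S. \<Sum>t\<in>S. if t = s then c s * w t else 0)"
      using eb S unfolding eigenbasis_def by (intro sum.cong refl) (auto simp: subset_iff)
    also have "\<dots> = (\<Sum>s\<in>S. c s * w s)" using fin by simp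
    finally show ?thesis .
  qed
  have mvg: "mv q M g i = (\<Sum>s\<in>S. (\<mu> s * w s) * v s i)" if "i < q" for i
  proof -
    have "mv q M g i = (\<Sum>k<q. \<Sum>s\<in>S. M i k * (w s * v s k))"
      unfolding mv_def using g by (simp add: sum_distrib_left)
    also have "\<dots> = (\<Sum>s\<in>S. \<Sum>k<q. M i k * (w s * v s k))" by (rule sum.swap)
    also have "\<dots> = (\<Sum>s\<in>S. w s * mv q M (v s) i)"
      by (simp add: mv_def sum_distrib_left mult_ac)
    also have "\<dots> = (\<Sum>s\<in>S. (\<mu> s * w s) * v s i)"
      using eb S that unfolding eigenbasis_def by (intro sum.cong refl) (auto simp: subset_iff)
    finally show ?thesis .
  qed
  have "dot q (mv q M g) g = dot q (\<lambda>k. \<Sum>s\<in>S. (\<mu> s * w s) * v s k) g"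
    unfolding dot_def using mvg by (intro sum.cong) auto
  then show "dot q (mv q M g) g = (\<Sum>s\<in>S. \<mu> s * (w s)\<^sup>2)"
    unfolding bil by (simp add: power2_eq_square mult.assoc)
  have "dot q g g = dot q (\<lambda>k. \<Sum>s\<in>S. w s * v s k) g"
    unfolding dot_def using g by (intro sum.cong) auto
  then show "dot q g g = (\<Sum>s\<in>S. (w s)\<^sup>2)"
    unfolding bil by (simp add: power2_eq_square)
qed

definition tridiag :: "(int \<Rightarrow> real) \<Rightarrow> (int \<Rightarrow> real) \<Rightarrow> (int \<Rightarrow> real) \<Rightarrow> int \<Rightarrow> real"
  where "tridiag a d f l = d (l - 1) * f (l - 1) + a l * f l + d l * f (l + 1)"

text \<open>Row and column \<open>i\<close> belong to the site \<open>n + 1 + i\<close>.\<close>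

definition dirichlet :: "(int \<Rightarrow> real) \<Rightarrow> (int \<Rightarrow> real) \<Rightarrow> int \<Rightarrow> nat \<Rightarrow> nat \<Rightarrow> real"
  where "dirichlet a d n i k =
    (if k = i then a (n + 1 + int i) else if k = Suc i then d (n + 1 + int i)
     else if i = Suc k then d (n + 1 + int k) else 0)"

lemma dirichlet_commute: "dirichlet a d n i k = dirichlet a d n k i"
  by (auto simp: dirichlet_def)

text \<open>The couplings that leave the block only reach the sites \<open>n\<close> and
  \<open>n + q + 1\<close>, where \<open>f\<close> vanishes.\<close>

lemma tridiag_eq_dirichlet:
  assumes f: "f n = 0" "f (n + int (Suc q)) = 0" and i: "i < q"
  shows "tridiag a d f (n + 1 + int i) = mv q (dirichlet a d n) (\<lambda>k. f (n + 1 + int k)) i"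
proof -
  have "mv q (dirichlet a d n) (\<lambda>k. f (n + 1 + int k)) i =
     (\<Sum>k<q. (if k = i then a (n + 1 + int k) * f (n + 1 + int k) else 0)
       + (if k = Suc i then d (n + 1 + int i) * f (n + 1 + int k) else 0)
       + (if i = Suc k then d (n + 1 + int k) * f (n + 1 + int k) else 0))"
    unfolding mv_def by (intro sum.cong) (auto simp: dirichlet_def)
  also have "\<dots> = a (n + 1 + int i) * f (n + 1 + int i)
      + (if Suc i < q then d (n + 1 + int i) * f (n + 1 + int (Suc i)) else 0)
      + (\<Sum>k<q. if i = Suc k then d (n + 1 + int k) * f (n + 1 + int k) else 0)"
    using i by (simp add: sum.distrib)
  also have "(if Suc i < q then d (n + 1 + int i) * f (n + 1 + int (Suc i)) else 0)
      = d (n + 1 + int i) * f (n + 1 + int i + 1)"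
  proof (cases "Suc i < q")
    case False
    then have "q = Suc i" using i by simp
    then show ?thesis using f(2) by (simp add: algebra_simps)
  qed (simp add: algebra_simps)
  also have "(\<Sum>k<q. if i = Suc k then d (n + 1 + int k) * f (n + 1 + int k) else 0)
      = d (n + int i) * f (n + int i)"
  proof (cases i)
    case 0
    then show ?thesis using f by simp
  next
    case (Suc j)
    then have "(\<Sum>k<q. if i = Suc k then d (n + 1 + int k) * f (n + 1 + int k) else 0)
       = (\<Sum>k<q. if k = j then d (n + 1 + int k) * f (n + 1 + int k) else 0)"
      by (intro sum.cong) auto
    then show ?thesis using Suc i by (simp add: algebra_simps)
  qed
  finally show ?thesis by (simp add: tridiag_def algebra_simps)
qed

text \<open>The sums include one site beyond the \<open>q\<close> entries of the matrix, the
  separating site where \<open>f\<close> is 0, so that consecutive blocks tile the line.\<close>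

lemma block_energy:
  assumes eb: "eigenbasis q (dirichlet a d n) v \<mu>" and S: "S \<subseteq> {..<q}"
    and f: "f n = 0" "f (n + int (Suc q)) = 0"
      "\<And>i. i < q \<Longrightarrow> f (n + 1 + int i) = (\<Sum>s\<in>S. w s * v s i)"
  shows "(\<Sum>i<Suc q. tridiag a d f (n + 1 + int i) * f (n + 1 + int i)) = (\<Sum>s\<in>S. \<mu> s * (w s)\<^sup>2)"
    and "(\<Sum>i<Suc q. (f (n + 1 + int i))\<^sup>2) = (\<Sum>s\<in>S. (w s)\<^sup>2)"
proof -
  have last: "f (n + 1 + int q) = 0" using f(2) by (simp add: algebra_simps)
  note energy = eigenbasis_energy[OF eb S, of "\<lambda>k. f (n + 1 + int k)", OF f(3)]
  show "(\<Sum>i<Suc q. tridiag a d f (n + 1 + int i) * f (n + 1 + int i)) = (\<Sum>s\<in>S. \<mu> s * (w s)\<^sup>2)"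
    using last energy(1) tridiag_eq_dirichlet[of f n q, OF f(1,2)] by (simp add: dot_def)
  show "(\<Sum>i<Suc q. (f (n + 1 + int i))\<^sup>2) = (\<Sum>s\<in>S. (w s)\<^sup>2)"
    using last energy(2) by (simp add: dot_def power2_eq_square)
qed

section \<open>Periodic sequences and sums over one period\<close>

lemma periodic_add_mult:
  assumes "periodic p x"
  shows "x (i + int p * k) = x i"
proof -
  have nat: "x (i + int p * int k) = x i" for i k
  proof (induction k)
    case (Suc k)
    have "x (i + int p * int (Suc k)) = x ((i + int p * int k) + int p)" by (simp add: algebra_simps)
    also have "\<dots> = x (i + int p * int k)" using assms unfolding periodic_def by blast
    finally show ?case using Suc by simp
  qed simp
  show ?thesis
  proof (cases "k \<ge> 0")
    case True
    then show ?thesis using nat[of i "nat k"] by simp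
  next
    case False
    then show ?thesis using nat[of "i + int p * k" "nat (- k)"] by simp
  qed
qed

lemma periodic_eqI:
  assumes "periodic P f" "periodic P g" "P > 0" "\<And>l. 0 \<le> l \<Longrightarrow> l < int P \<Longrightarrow> f l = g l"
  shows "f l = g l"
proof -
  have "f l = f (l mod int P)" "g l = g (l mod int P)"
    using periodic_add_mult[OF assms(1), of "l mod int P" "l div int P"]
      periodic_add_mult[OF assms(2), of "l mod int P" "l div int P"] by simp_all
  then show ?thesis using assms(3,4) by simp
qed

lemma periodic_multiple: "periodic p x \<Longrightarrow> periodic (N * p) x"
  using periodic_add_mult[of p x _ "int N"] by (simp add: periodic_def mult.commute)

lemma periodic_translate:
  assumes "periodic p x"
  shows "periodic p (\<lambda>l. x (l + m))"
  unfolding periodic_def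
proof
  fix l
  show "x (l + int p + m) = x (l + m)"
    using assms[unfolded periodic_def, rule_format, of "l + m"] by (simp add: algebra_simps)
qed

lemma periodic_add: "periodic p x \<Longrightarrow> periodic p y \<Longrightarrow> periodic p (\<lambda>l. x l + y l)"
  by (simp add: periodic_def)

lemma periodic_mult: "periodic p x \<Longrightarrow> periodic p y \<Longrightarrow> periodic p (\<lambda>l. x l * y l)"
  by (simp add: periodic_def)

lemma periodic_tridiag:
  assumes "periodic p a" "periodic p d" "periodic p f"
  shows "periodic p (tridiag a d f)"
proof -
  have "periodic p (\<lambda>l. d (l + -1) * f (l + -1) + a l * f l + d l * f (l + 1))"
    by (intro periodic_add periodic_mult periodic_translate assms)
  then show ?thesis by (simp add: tridiag_def[abs_def])
qed

lemma sum_periodic_shift: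
  assumes "periodic P F"
  shows "(\<Sum>i<P. F (m + int i)) = (\<Sum>i<P. F (int i))"
proof -
  have step: "(\<Sum>i<P. F (m + 1 + int i)) = (\<Sum>i<P. F (m + int i))" for m
  proof -
    have "F m + (\<Sum>i<P. F (m + int (Suc i))) = (\<Sum>i<Suc P. F (m + int i))"
      by (subst sum.lessThan_Suc_shift) simp
    also have "\<dots> = (\<Sum>i<P. F (m + int i)) + F m"
      using assms by (simp add: periodic_def)
    finally show ?thesis by (simp add: algebra_simps)
  qed
  show ?thesis
  proof (induction m rule: int_induct[where k = 0])
    case (step2 i)
    then show ?case using step[of "i - 1"] by simp
  qed (simp_all add: step)
qed

lemma sum_blocks: "(\<Sum>i<N * p. F i) = (\<Sum>t<N. \<Sum>i<p. F (t * p + i))" for F :: "nat \<Rightarrow> real"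
proof -
  have "(\<Sum>i<N * p. F i) = (\<Sum>t<N. sum F {t * p..<t * p + p})"
    by (rule sum.nat_group[symmetric])
  also have "\<dots> = (\<Sum>t<N. \<Sum>i<p. F (t * p + i))"
  proof (rule sum.cong[OF refl])
    fix t
    show "sum F {t * p..<t * p + p} = (\<Sum>i<p. F (t * p + i))"
      using sum.shift_bounds_nat_ivl[of F 0 "t * p" p] by (simp add: add.commute lessThan_atLeast0)
  qed
  finally show ?thesis .
qed

text \<open>Summation by parts on a cycle: a shift by one site turns each lower coupling term into
  an upper one.\<close>

lemma tridiag_sum_commute:
  assumes "periodic P d" "periodic P f" "periodic P g"
  shows "(\<Sum>i<P. tridiag a d f (int i) * g (int i)) = (\<Sum>i<P. f (int i) * tridiag a d g (int i))"
proof -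
  have shift: "(\<Sum>i<P. d (int i - 1) * x (int i - 1) * y (int i)) = (\<Sum>i<P. d (int i) * x (int i) * y (int i + 1))"
    if "periodic P x" "periodic P y" for x y
  proof -
    have "periodic P (\<lambda>l. d l * x l * y (l + 1))"
      by (intro periodic_mult periodic_translate assms that)
    from sum_periodic_shift[OF this, of "-1"] show ?thesis by (simp add: algebra_simps)
  qed
  note 1 = shift[OF assms(2,3)] and 2 = shift[OF assms(3,2)]
  from 1 2 show ?thesis
    by (simp add: tridiag_def distrib_right distrib_left sum.distrib mult_ac)
qed

text \<open>
  Site \<open>n + 1 + t (q + 1) + i\<close> carries entry \<open>i\<close> of block \<open>t\<close>; the separating sites \<open>n + t (q + 1)\<close>
  are those with \<open>i = q\<close>, where the value is \<open>0\<close>.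
\<close>

definition block_combination ::
    "nat \<Rightarrow> nat \<Rightarrow> int \<Rightarrow> (nat \<Rightarrow> nat \<Rightarrow> real) \<Rightarrow> nat set \<Rightarrow> (nat \<Rightarrow> nat \<Rightarrow> real) \<Rightarrow> int \<Rightarrow> real"
  where "block_combination N q n v S w l =
    (let r = (l - (n + 1)) mod int (N * Suc q); i = nat (r mod int (Suc q)) in
     if i < q then \<Sum>s\<in>S. w (nat (r div int (Suc q))) s * v s i else 0)"

lemma periodic_block_combination: "periodic (N * Suc q) (block_combination N q n v S w)"
  unfolding periodic_def
proof
  fix l
  have "(l + int (N * Suc q) - (n + 1)) mod int (N * Suc q) = (l - (n + 1)) mod int (N * Suc q)"
    by (metis add_diff_eq add.commute mod_add_self1)
  then show "block_combination N q n v S w (l + int (N * Suc q)) = block_combination N q n v S w l"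
    by (simp only: block_combination_def)
qed

lemma block_combination_boundary:
  "block_combination N q n v S w (n + int (t * Suc q)) = 0"
proof -
  have "((n + int (t * Suc q) - (n + 1)) mod int (N * Suc q)) mod int (Suc q)
      = (int (t * Suc q) - 1) mod int (Suc q)"
    by (subst mod_mod_cancel) (simp_all only: of_nat_mult dvd_triv_right, simp)
  \<comment> \<open>Here \<open>-1\<close> becomes \<open>q\<close> modulo \<open>q + 1\<close>, the
    residue of a separating site.\<close>
  also have "\<dots> = (int q + int (Suc q) * (int t - 1)) mod int (Suc q)"
    by (simp add: algebra_simps)
  also have "\<dots> = int q" by (subst mod_mult_self2) simp
  finally show ?thesis by (simp add: block_combination_def Let_def del: of_nat_Suc of_nat_mult)
qed

lemma block_combination_interior:
  assumes "t < N" "i < q"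
  shows "block_combination N q n v S w (n + int (t * Suc q) + 1 + int i) = (\<Sum>s\<in>S. w t s * v s i)"
proof -
  have "t * Suc q + i < Suc t * Suc q" using assms by simp
  also have "\<dots> \<le> N * Suc q" using assms by (intro mult_le_mono) auto
  finally have 1: "int (t * Suc q + i) mod int (N * Suc q) = int (t * Suc q + i)"
    by (intro mod_pos_pos_trivial) (simp_all only: of_nat_0_le_iff of_nat_less_iff)
  have 2: "n + int (t * Suc q) + 1 + int i - (n + 1) = int (t * Suc q + i)" by simp
  have 3: "int (t * Suc q + i) mod int (Suc q) = int i"
    using assms by (simp flip: of_nat_mod del: of_nat_add of_nat_mult of_nat_Suc mult_Suc_right)
  have 4: "int (t * Suc q + i) div int (Suc q) = int t"
    using assms by (simp flip: of_nat_div del: of_nat_add of_nat_mult of_nat_Suc mult_Suc_right)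
  show ?thesis
    unfolding block_combination_def Let_def 2 1 3 4 using assms by simp
qed

text \<open>By periodicity all blocks have the same Dirichlet matrix, and the zeros between them
  make the energies of the blocks add up.\<close>

lemma block_combination_energy:
  fixes N :: nat and w :: "nat \<Rightarrow> nat \<Rightarrow> real"
  assumes per: "periodic (Suc q) a" "periodic (Suc q) d"
    and eb: "eigenbasis q (dirichlet a d n) v \<mu>" and S: "S \<subseteq> {..<q}"
  defines "f \<equiv> block_combination N q n v S w"
  shows "(\<Sum>i<N * Suc q. tridiag a d f (int i) * f (int i)) = (\<Sum>t<N. \<Sum>s\<in>S. \<mu> s * (w t s)\<^sup>2)"
    and "(\<Sum>i<N * Suc q. (f (int i))\<^sup>2) = (\<Sum>t<N. \<Sum>s\<in>S. (w t s)\<^sup>2)"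
proof -
  let ?P = "N * Suc q"
  have perf: "periodic ?P f" unfolding f_def by (rule periodic_block_combination)
  have pera: "periodic ?P a" "periodic ?P d" by (rule periodic_multiple, fact)+
  have split: "(\<Sum>i<?P. F (int i)) = (\<Sum>t<N. \<Sum>i<Suc q. F (n + int (t * Suc q) + 1 + int i))"
    if "periodic ?P F" for F :: "int \<Rightarrow> real"
  proof -
    \<comment> \<open>Starting the period at \<open>n + 1\<close> aligns it with the blocks.\<close>
    have "(\<Sum>i<?P. F (int i)) = (\<Sum>i<?P. F (n + 1 + int i))"
      by (rule sum_periodic_shift[OF that, symmetric])
    also have "\<dots> = (\<Sum>t<N. \<Sum>i<Suc q. F (n + 1 + int (t * Suc q + i)))"
      by (rule sum_blocks)
    finally show ?thesis by (simp add: algebra_simps)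
  qed
  have dir: "dirichlet a d (n + int (t * Suc q)) = dirichlet a d n" for t
  proof -
    have "x (n + int (t * Suc q) + 1 + int i) = x (n + 1 + int i)" if "periodic (Suc q) x" for x i
      using periodic_add_mult[OF that, of "n + 1 + int i" "int t"] by (simp add: algebra_simps)
    then show ?thesis using per unfolding dirichlet_def by (intro ext) auto
  qed
  have "f (n + int (t * Suc q)) = 0" "f (n + int (t * Suc q) + int (Suc q)) = 0" for t
    using block_combination_boundary[of N q n v S w t] block_combination_boundary[of N q n v S w "Suc t"]
    unfolding f_def by (simp_all add: algebra_simps)
  note boundary = this
  have eb': "eigenbasis q (dirichlet a d (n + int (t * Suc q))) v \<mu>" for t
    using eb by (simp only: dir)
  have int: "f (n + int (t * Suc q) + 1 + int i) = (\<Sum>s\<in>S. w t s * v s i)" if "t < N" "i < q" for t i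
    unfolding f_def by (rule block_combination_interior) fact+
  note energy = block_energy[OF eb' S boundary int]
  have "periodic ?P (\<lambda>l. tridiag a d f l * f l)"
    by (intro periodic_mult periodic_tridiag pera perf)
  from split[OF this] show "(\<Sum>i<?P. tridiag a d f (int i) * f (int i)) = (\<Sum>t<N. \<Sum>s\<in>S. \<mu> s * (w t s)\<^sup>2)"
    using energy(1) by simp
  have "periodic ?P (\<lambda>l. (f l)\<^sup>2)" using perf by (simp add: periodic_def)
  from split[OF this] show "(\<Sum>i<?P. (f (int i))\<^sup>2) = (\<Sum>t<N. \<Sum>s\<in>S. (w t s)\<^sup>2)"
    using energy(2) by simp
qed

text \<open>Linearity in the coefficients \<open>w\<close>, in the form that
  \<open>square_system_solution\<close> needs: each summand is a coefficient times an eigenvector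
  placed in a single block \<open>t\<close>.\<close>

lemma block_combination_eq_sum:
  assumes N: "N > 0" and S: "finite S"
  shows "block_combination N q n v S w l = (\<Sum>t<N. \<Sum>s\<in>S. w t s *
    block_combination N q n v {s} (\<lambda>t' _. if t' = t then 1 else 0) l)"
proof -
  define r where "r = (l - (n + 1)) mod int (N * Suc q)"
  define i where "i = nat (r mod int (Suc q))"
  define t0 where "t0 = nat (r div int (Suc q))"
  have P: "0 < int (N * Suc q)" using N by (simp del: of_nat_mult of_nat_Suc mult_Suc_right)
  have r: "0 \<le> r" "r < int (Suc q) * int N"
    using pos_mod_sign[OF P] pos_mod_bound[OF P] unfolding r_def by (simp_all only: of_nat_mult mult.commute)
  have "r div int (Suc q) < int N"
  proof (rule ccontr)
    assume "\<not> r div int (Suc q) < int N"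
    then have "int N \<le> r div int (Suc q)" by simp
    then have "int (Suc q) * int N \<le> int (Suc q) * (r div int (Suc q))" by (rule mult_left_mono) simp
    also have "\<dots> \<le> r" using pos_mod_sign[of "int (Suc q)" r] mult_div_mod_eq[of "int (Suc q)" r] by linarith
    finally show False using r by simp
  qed
  then have "t0 < N" using N by (simp add: t0_def nat_less_iff)
  have bc: "block_combination N q n v S w l = (if i < q then \<Sum>s\<in>S. w t0 s * v s i else 0)" for S w
    by (simp only: block_combination_def Let_def r_def i_def t0_def)
  show ?thesis
  proof (cases "i < q")
    case True
    have "(\<Sum>t<N. \<Sum>s\<in>S. w t s * block_combination N q n v {s} (\<lambda>t' _. if t' = t then 1 else 0) l)
      = (\<Sum>t<N. if t = t0 then \<Sum>s\<in>S. w t s * v s i else 0)"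
      unfolding bc using True by (intro sum.cong) auto
    also have "\<dots> = block_combination N q n v S w l"
      unfolding bc using True \<open>t0 < N\<close> by simp
    finally show ?thesis by simp
  qed (simp add: bc)
qed

lemma eigenbasis_mono: "eigenbasis q M v \<mu> \<Longrightarrow> s \<le> t \<Longrightarrow> t < q \<Longrightarrow> \<mu> s \<le> \<mu> t"
  by (simp add: eigenbasis_def)

text \<open>The gap between \<open>x - h\<close> and \<open>x + h\<close>, stated as a lower bound
  for the operator minus \<open>x\<close>. Closing the chain to a cycle makes unknowns and sites
  countable while all periods stay alike.\<close>

theorem torus_gap:
  assumes N: "N > 0" and per: "periodic (Suc q) a" "periodic (Suc q) d"
    and eb: "eigenbasis q (dirichlet a d n) v \<mu>" "eigenbasis q (dirichlet a d m) v' \<mu>'"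
    and j: "j < q" "\<mu> j = x - h" "\<mu>' j = x + h" and h: "h > 0"
    and u: "periodic (N * Suc q) u"
  shows "h\<^sup>2 * (\<Sum>i<N * Suc q. (u (int i))\<^sup>2) \<le> (\<Sum>i<N * Suc q. (tridiag a d u (int i) - x * u (int i))\<^sup>2)"
proof -
  define P where "P = N * Suc q"
  have P: "P > 0" using N by (simp add: P_def)
  note perP = periodic_multiple[OF per(1), of N, folded P_def] periodic_multiple[OF per(2), of N, folded P_def]
  \<comment> \<open>The index \<open>j\<close> counts from 0 and lies in both sets: \<open>S\<close>
    and \<open>S'\<close> have \<open>j + 1\<close> and \<open>q - j\<close> elements, together
    \<open>q + 1\<close>, one for each site of a period.\<close>
  define S where "S = {..j}"
  define S' where "S' = {j..<q}"
  have S: "S \<subseteq> {..<q}" "finite S" "S' \<subseteq> {..<q}" "finite S'" using j by (auto simp: S_def S'_def)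
  define T where "T f g = (\<Sum>i<P. f (int i) * g (int i))" for f g :: "int \<Rightarrow> real"
  have T_add: "T (\<lambda>l. f l + r * g l) k = T f k + r * T g k" "T k (\<lambda>l. f l + r * g l) = T k f + r * T k g" for f g k r
    by (simp_all add: T_def algebra_simps sum.distrib sum_distrib_left)
  have T_nonneg: "T f f \<ge> 0" for f by (simp add: T_def sum_nonneg)
  define L where "L w = block_combination N q n v S (\<lambda>t s. w (t, Inl s))" for w :: "nat \<times> (nat + nat) \<Rightarrow> real"
  define R where "R w = block_combination N q m v' S' (\<lambda>t s. w (t, Inr s))" for w :: "nat \<times> (nat + nat) \<Rightarrow> real"
  have perL: "periodic P (L w)" and perR: "periodic P (R w)" for w
    unfolding L_def R_def P_def by (rule periodic_block_combination)+
  have EL: "T (tridiag a d (L w)) (L w) \<le> (x - h) * T (L w) (L w)"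
    and NL: "T (L w) (L w) = (\<Sum>t<N. \<Sum>s\<in>S. (w (t, Inl s))\<^sup>2)" for w
  proof -
    note e = block_combination_energy[OF per eb(1) S(1), of N "\<lambda>t s. w (t, Inl s)", folded L_def P_def]
    show N2: "T (L w) (L w) = (\<Sum>t<N. \<Sum>s\<in>S. (w (t, Inl s))\<^sup>2)"
      using e(2) by (simp add: T_def power2_eq_square)
    have "\<mu> s \<le> x - h" if "s \<in> S" for s
      using eigenbasis_mono[OF eb(1), of s j] that j by (simp add: S_def)
    then show "T (tridiag a d (L w)) (L w) \<le> (x - h) * T (L w) (L w)"
      unfolding N2 using e(1) unfolding T_def sum_distrib_left
      by (auto intro!: sum_mono mult_right_mono)
  qed
  have ER: "T (tridiag a d (R w)) (R w) \<ge> (x + h) * T (R w) (R w)"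
    and NR: "T (R w) (R w) = (\<Sum>t<N. \<Sum>s\<in>S'. (w (t, Inr s))\<^sup>2)" for w
  proof -
    note e = block_combination_energy[OF per eb(2) S(3), of N "\<lambda>t s. w (t, Inr s)", folded R_def P_def]
    show N2: "T (R w) (R w) = (\<Sum>t<N. \<Sum>s\<in>S'. (w (t, Inr s))\<^sup>2)"
      using e(2) by (simp add: T_def power2_eq_square)
    have "x + h \<le> \<mu>' s" if "s \<in> S'" for s
      using eigenbasis_mono[OF eb(2), of j s] that j by (simp add: S'_def)
    then show "(x + h) * T (R w) (R w) \<le> T (tridiag a d (R w)) (R w)"
      unfolding N2 using e(1) unfolding T_def sum_distrib_left
      by (auto intro!: sum_mono mult_right_mono)
  qed
  define I where "I = {..<N} \<times> (S <+> S')"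
  define G where "G p i = (case snd p of
      Inl s \<Rightarrow> block_combination N q n v {s} (\<lambda>t' _. if t' = fst p then 1 else 0) (int i)
    | Inr s \<Rightarrow> block_combination N q m v' {s} (\<lambda>t' _. if t' = fst p then 1 else 0) (int i))"
    for p :: "nat \<times> (nat + nat)" and i :: nat
  have lin: "(\<Sum>p\<in>I. w p * G p i) = L w (int i) + R w (int i)" for w i
  proof -
    have "(\<Sum>p\<in>I. w p * G p i) = (\<Sum>(t, s)\<in>{..<N} \<times> (S <+> S'). w (t, s) * G (t, s) i)"
      by (simp add: I_def case_prod_unfold)
    also have "\<dots> = (\<Sum>t<N. \<Sum>s\<in>S <+> S'. w (t, s) * G (t, s) i)"
      by (rule sum.cartesian_product[symmetric])
    also have "\<dots> = (\<Sum>t<N. (\<Sum>s\<in>S. w (t, Inl s) * G (t, Inl s) i) + (\<Sum>s\<in>S'. w (t, Inr s) * G (t, Inr s) i))"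
      using S(2,4) by (simp add: sum.Plus)
    also have "\<dots> = L w (int i) + R w (int i)"
      unfolding L_def R_def block_combination_eq_sum[OF N S(2)] block_combination_eq_sum[OF N S(4)]
      by (simp add: G_def sum.distrib)
    finally show ?thesis .
  qed
  have "\<exists>w. \<forall>i\<in>{..<P}. (\<Sum>p\<in>I. w p * G p i) = u (int i)"
  proof (rule square_system_solution)
    show "finite I" using S by (simp add: I_def)
    have "card (S <+> S') = Suc q"
      using S j by (simp add: card_Plus) (simp add: S_def S'_def)
    then show "card I = card {..<P}"
      by (simp add: I_def P_def card_cartesian_product)
  next
    fix w p
    assume "\<forall>i\<in>{..<P}. (\<Sum>p\<in>I. w p * G p i) = 0" and p: "p \<in> I"
    then have *: "L w (int i) = - R w (int i)" if "i < P" for i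
      using that by (simp add: lin add_eq_0_iff2)
    \<comment> \<open>Agreement at all sites is needed, since \<open>tridiag\<close> also reads the
      neighbours just outside the period.\<close>
    have "L w l = - R w l" for l
    proof (rule periodic_eqI[OF perL _ P])
      show "periodic P (\<lambda>l. - R w l)" using perR by (simp add: periodic_def)
      show "L w l = - R w l" if "0 \<le> l" "l < int P" for l
        using *[of "nat l"] that by (simp add: nat_less_iff)
    qed
    then have LR: "L w = (\<lambda>l. - R w l)" by (rule ext)
    have "T (L w) (L w) = T (R w) (R w)" "T (tridiag a d (L w)) (L w) = T (tridiag a d (R w)) (R w)"
      unfolding LR by (simp_all add: T_def tridiag_def algebra_simps)
    \<comment> \<open>The same function, up to sign, has energy at most \<open>x - h\<close> and at
      least \<open>x + h\<close> times its squared norm, so it is zero; \<open>NL\<close> and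
      \<open>NR\<close> then annihilate all coefficients.\<close>
    with EL[of w] ER[of w] have "(x + h) * T (R w) (R w) \<le> (x - h) * T (R w) (R w)" by simp
    then have "h * T (R w) (R w) \<le> 0" by (simp add: algebra_simps)
    then have "T (R w) (R w) = 0" using h T_nonneg[of "R w"] by (simp add: mult_le_0_iff)
    then have "T (L w) (L w) = 0" "T (R w) (R w) = 0"
      using \<open>T (L w) (L w) = T (R w) (R w)\<close> by simp_all
    then show "w p = 0" using p S unfolding NL NR
      by (auto simp: I_def sum_nonneg_eq_0_iff sum_nonneg)
  qed simp
  then obtain w where w: "\<And>i. i < P \<Longrightarrow> L w (int i) + R w (int i) = u (int i)"
    unfolding lin by auto
  define f where "f = L w"
  define g where "g = R w"
  have perf: "periodic P f" "periodic P g" unfolding f_def g_def by (rule perL perR)+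
  have "u l = f l + g l" for l
  proof (rule periodic_eqI[OF u[folded P_def] periodic_add[OF perf] P])
    show "u l = f l + g l" if "0 \<le> l" "l < int P" for l
      using w[of "nat l"] that by (simp add: nat_less_iff f_def g_def)
  qed
  then have ufg: "u = (\<lambda>l. f l + 1 * g l)" by auto
  define A where "A f = (\<lambda>l. tridiag a d f l + (- x) * f l)" for f
  have A_add: "A (\<lambda>l. f l + r * g l) = (\<lambda>l. A f l + r * A g l)" for f g r
    by (simp add: A_def tridiag_def fun_eq_iff algebra_simps)
  have sym: "T (A f) g = T f (A g)"
    unfolding A_def T_add using tridiag_sum_commute[OF perP(2) perf] by (simp add: T_def)
  have comm: "T f g = T g f" for f g by (simp add: T_def mult.commute)
  have "T (A f) f \<le> - h * T f f" "T (A g) g \<ge> h * T g g"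
    unfolding A_def T_add using EL[of w] ER[of w] by (simp_all add: f_def g_def algebra_simps)
  moreover define z where "z = (\<lambda>l. g l + (- 1) * f l)"
  moreover have "T (A u) z = T (A g) g - T (A f) f"
    unfolding ufg z_def A_add T_add using sym comm[of f "A g"] by (simp add: T_add)
  ultimately have low: "T (A u) z \<ge> h * (T f f + T g g)" by (simp add: algebra_simps)
  \<comment> \<open>Completing the square takes the place of Cauchy-Schwarz; the parallelogram
    identity below converts the bound in \<open>f\<close> and \<open>g\<close> into one in
    \<open>u\<close> and cancels \<open>T z z\<close>.\<close>
  have "0 \<le> T (\<lambda>l. A u l + (- h) * z l) (\<lambda>l. A u l + (- h) * z l)" by (rule T_nonneg)
  also have "\<dots> = T (A u) (A u) - 2 * h * T (A u) z + h\<^sup>2 * T z z"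
    unfolding T_add using comm[of z "A u"] by (simp add: algebra_simps power2_eq_square)
  finally have "2 * h * T (A u) z \<le> T (A u) (A u) + h\<^sup>2 * T z z" by simp
  moreover have "2 * h * (h * (T f f + T g g)) \<le> 2 * h * T (A u) z"
    using low h by (intro mult_left_mono) auto
  moreover have "T u u + T z z = 2 * (T f f + T g g)"
    unfolding ufg z_def T_add using comm[of f g] by simp
  then have "h\<^sup>2 * (T u u + T z z) = 2 * h * (h * (T f f + T g g))"
    by (simp add: power2_eq_square)
  ultimately have "h\<^sup>2 * T u u \<le> T (A u) (A u)" by (simp add: algebra_simps)
  then show ?thesis by (simp add: T_def A_def P_def power2_eq_square)
qed

text \<open>A finitely supported \<open>u\<close> is wrapped onto a cycle too long for its ends to
  interact. As \<open>u\<close> already vanishes at distance \<open>K\<close>, its image under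
  \<open>tridiag\<close> lives in \<open>{- int K..int K}\<close>.\<close>

corollary finite_support_gap:
  assumes per: "periodic (Suc q) a" "periodic (Suc q) d"
    and eb: "eigenbasis q (dirichlet a d n) v \<mu>" "eigenbasis q (dirichlet a d m) v' \<mu>'"
    and j: "j < q" "\<mu> j = x - h" "\<mu>' j = x + h" and h: "h > 0"
    and u: "\<And>l. \<bar>l\<bar> \<ge> int K \<Longrightarrow> u l = 0"
  shows "h\<^sup>2 * (\<Sum>l\<in>{- int K..int K}. (u l)\<^sup>2) \<le> (\<Sum>l\<in>{- int K..int K}. (tridiag a d u l - x * u l)\<^sup>2)"
proof -
  \<comment> \<open>With this choice a period holds the whole window and at least one further zero
    site, whatever \<open>q\<close> is.\<close>
  define N where "N = 2 * K + 2"
  define P where "P = N * Suc q"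
  have "N * 1 \<le> P" unfolding P_def by (intro mult_le_mono) auto
  then have P: "int P \<ge> 2 * int K + 2" by (simp add: N_def)
  define f where "f l = u (- int K + (l + int K) mod int P)" for l
  have perf: "periodic P f"
    unfolding periodic_def f_def by (metis add.assoc add.commute mod_add_self2)
  \<comment> \<open>The range exceeds a period by one site at each end, so that
    \<open>tridiag\<close> agrees on the full period.\<close>
  have fu: "f l = u l" if l: "- int K - 1 \<le> l" "l \<le> int P - int K" for l
  proof -
    consider "l = - int K - 1" | "l = int P - int K" | "- int K \<le> l" "l < int P - int K" using l by linarith
    then show ?thesis
    proof cases
      case 1
      have "(l + int K) mod int P = int P - 1"
        using 1 P zmod_minus1[of "int P"] by simp
      then show ?thesis using 1 P u[of l] u[of "- int K + (int P - 1)"] by (simp add: f_def)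
    next
      case 2
      then show ?thesis using P u[of l] u[of "- int K"] by (simp add: f_def)
    next
      case 3
      then show ?thesis by (simp add: f_def)
    qed
  qed
  have window: "(\<Sum>i<P. F (int i)) = (\<Sum>l\<in>{- int K..int K}. F' l)"
    if F: "periodic P F" and F': "\<And>l. - int K \<le> l \<Longrightarrow> l < int P - int K \<Longrightarrow> F l = F' l"
      "\<And>l. \<bar>l\<bar> > int K \<Longrightarrow> F' l = 0" for F F' :: "int \<Rightarrow> real"
  proof -
    have "(\<Sum>i<P. F (int i)) = (\<Sum>i<P. F (- int K + int i))"
      by (rule sum_periodic_shift[OF F, symmetric])
    also have "\<dots> = (\<Sum>i<P. F' (- int K + int i))"
      using F' by (intro sum.cong) auto
    also have "\<dots> = (\<Sum>l\<in>{- int K..<int P - int K}. F' l)"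
      by (rule sum.reindex_bij_witness[of _ "\<lambda>l. nat (l + int K)" "\<lambda>i. - int K + int i"]) auto
    also have "\<dots> = (\<Sum>l\<in>{- int K..int K}. F' l)"
      using P F'(2) by (intro sum.mono_neutral_right) auto
    finally show ?thesis .
  qed
  have tri: "tridiag a d f l = tridiag a d u l" if "- int K \<le> l" "l < int P - int K" for l
    using fu[of "l - 1"] fu[of l] fu[of "l + 1"] that by (simp add: tridiag_def)
  have z: "u l = 0" "tridiag a d u l = 0" if "\<bar>l\<bar> > int K" for l
  proof -
    have "int K \<le> \<bar>l - 1\<bar>" "int K \<le> \<bar>l\<bar>" "int K \<le> \<bar>l + 1\<bar>" using that by linarith+
    then show "u l = 0" "tridiag a d u l = 0" using u[of "l - 1"] u[of l] u[of "l + 1"]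
      by (simp_all add: tridiag_def)
  qed
  note perP = periodic_multiple[OF per(1), of N, folded P_def] periodic_multiple[OF per(2), of N, folded P_def]
  have per2: "periodic P (\<lambda>l. (f l)\<^sup>2)" "periodic P (\<lambda>l. (tridiag a d f l - x * f l)\<^sup>2)"
    using perf periodic_tridiag[OF perP perf] by (simp_all add: periodic_def)
  have "(\<Sum>i<P. (f (int i))\<^sup>2) = (\<Sum>l\<in>{- int K..int K}. (u l)\<^sup>2)"
    using fu z by (intro window[OF per2(1)]) auto
  moreover have "(\<Sum>i<P. (tridiag a d f (int i) - x * f (int i))\<^sup>2) =
      (\<Sum>l\<in>{- int K..int K}. (tridiag a d u l - x * u l)\<^sup>2)"
    using fu tri z by (intro window[OF per2(2)]) auto
  moreover have "N > 0" by (simp add: N_def)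
  ultimately show ?thesis
    using torus_gap[OF _ per eb j h perf[unfolded P_def]] by (simp add: P_def)
qed

subsection \<open>Bounded operators and pseudospectra\<close>

text \<open>Injectivity is immediate from the lower bound for \<open>A\<close>. For surjectivity,
  \<open>C = A B\<close> satisfies \<open>inner (C w) w = (norm (B w))^2\<close>, so it is coercive,
  and the damped iteration \<open>u - \<tau> (C u - f)\<close> is a contraction; its fixed point
  \<open>u\<close> gives \<open>A (B u) = f\<close>.\<close>

lemma coercive_adjoint_pair_bij:
  fixes A B :: "'a::{real_inner, banach} \<Rightarrow> 'a"
  assumes A: "bounded_linear A" and B: "bounded_linear B" and adj: "\<And>u v. inner (A u) v = inner u (B v)"
    and \<delta>: "\<delta> > 0" "\<And>u. \<delta> * norm u \<le> norm (A u)" "\<And>u. \<delta> * norm u \<le> norm (B u)"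
  shows "bij A"
proof (rule bijI)
  interpret A: bounded_linear A by fact
  interpret B: bounded_linear B by fact
  show "inj A"
  proof (rule injI)
    fix u v assume "A u = A v"
    then have "A (u - v) = 0" by (simp add: A.diff)
    then have "\<delta> * norm (u - v) \<le> 0" using \<delta>(2)[of "u - v"] by simp
    then show "u = v" using \<delta>(1) by (simp add: mult_le_0_iff)
  qed
  define C where "C u = A (B u)" for u
  interpret C: bounded_linear C unfolding C_def using bounded_linear_compose[OF A B] by simp
  obtain K0 where K0: "\<And>u. norm (C u) \<le> norm u * K0" using C.bounded by blast
  \<comment> \<open>The maximum with the square of \<open>\<delta>\<close> makes \<open>K\<close>
    positive and the radicand of \<open>c\<close> nonnegative.\<close>
  define K where "K = max K0 (\<delta>\<^sup>2)"
  have K: "K > 0" "\<delta>\<^sup>2 \<le> K" "norm (C u) \<le> K * norm u" for u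
  proof -
    show "K > 0" "\<delta>\<^sup>2 \<le> K" using \<delta>(1) by (auto simp: K_def less_max_iff_disj)
    have "norm u * K0 \<le> norm u * K" by (intro mult_left_mono) (auto simp: K_def)
    with K0[of u] show "norm (C u) \<le> K * norm u" by (simp add: mult.commute)
  qed
  \<comment> \<open>The minimizer of \<open>1 - 2 \<tau> \<delta>^2 + \<tau>^2 K^2\<close>; the
    minimum is \<open>c^2\<close>.\<close>
  define \<tau> where "\<tau> = \<delta>\<^sup>2 / K\<^sup>2"
  define c where "c = sqrt (1 - (\<delta>\<^sup>2 / K)\<^sup>2)"
  have "\<delta>\<^sup>2 / K \<le> 1" "0 < \<delta>\<^sup>2 / K" using K(1,2) \<delta>(1) by auto
  then have c1: "(\<delta>\<^sup>2 / K)\<^sup>2 \<le> 1" "(\<delta>\<^sup>2 / K)\<^sup>2 > 0"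
    using K(1) \<delta>(1) by (simp_all add: power_le_one)
  then have c: "0 \<le> c" "c < 1" "c\<^sup>2 = 1 - (\<delta>\<^sup>2 / K)\<^sup>2" by (auto simp: c_def)
  have contr: "norm (w - \<tau> *\<^sub>R C w) \<le> c * norm w" for w
  proof (rule power2_le_imp_le)
    have "\<delta>\<^sup>2 * (norm w)\<^sup>2 = (\<delta> * norm w)\<^sup>2" by (simp add: power_mult_distrib)
    also have "\<dots> \<le> (norm (B w))\<^sup>2" using \<delta> by (intro power_mono) auto
    also have "\<dots> = inner (C w) w" by (simp add: C_def adj dot_square_norm)
    finally have low: "\<delta>\<^sup>2 * (norm w)\<^sup>2 \<le> inner (C w) w" .
    have "(norm (C w))\<^sup>2 \<le> (K * norm w)\<^sup>2" using K(3) by (intro power_mono) auto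
    then have up: "(norm (C w))\<^sup>2 \<le> K\<^sup>2 * (norm w)\<^sup>2" by (simp add: power_mult_distrib)
    have "(norm (w - \<tau> *\<^sub>R C w))\<^sup>2 = (norm w)\<^sup>2 - 2 * \<tau> * inner (C w) w + \<tau>\<^sup>2 * (norm (C w))\<^sup>2"
      unfolding power2_norm_eq_inner
      by (simp add: inner_diff_left inner_diff_right inner_commute[of w "C w"] power2_eq_square algebra_simps)
    also have "\<dots> \<le> (norm w)\<^sup>2 - 2 * \<tau> * (\<delta>\<^sup>2 * (norm w)\<^sup>2) + \<tau>\<^sup>2 * (K\<^sup>2 * (norm w)\<^sup>2)"
      using low up K(1) by (intro add_mono diff_mono mult_left_mono) (auto simp: \<tau>_def)
    also have "\<dots> = (1 - (\<delta>\<^sup>2 / K)\<^sup>2) * (norm w)\<^sup>2"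
      using K(1) by (simp add: \<tau>_def field_simps power2_eq_square)
    finally show "(norm (w - \<tau> *\<^sub>R C w))\<^sup>2 \<le> (c * norm w)\<^sup>2"
      by (simp add: power_mult_distrib c(3))
  qed (use c in auto)
  have "\<exists>u. A u = f" for f
  proof -
    define g where "g u = u - \<tau> *\<^sub>R (C u - f)" for u
    have "dist (g u) (g v) \<le> c * dist u v" for u v
      using contr[of "u - v"] by (simp add: g_def dist_norm C.diff algebra_simps)
    then have "\<exists>!u. g u = u" using c by (intro banach_fix_type) auto
    then obtain u where "g u = u" by blast
    then have "C u = f" using K(1) \<delta>(1) by (simp add: g_def \<tau>_def)
    then show ?thesis by (auto simp: C_def)
  qed
  then show "surj A" by (metis surjI)
qed

text \<open>At the supremum \<open>M\<close> of the numerical range, \<open>T = M - A\<close> is a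
  positive operator, so the norm of \<open>T u\<close> is controlled by
  \<open>inner (T u) u\<close>, which unit vectors make arbitrarily small.\<close>

lemma selfadjoint_sup_approx_eigenvalue:
  fixes A :: "'a::real_inner \<Rightarrow> 'a" and e :: 'a
  assumes A: "bounded_linear A" and sym: "\<And>u v. inner (A u) v = inner u (A v)"
    and e: "norm e = 1"
  obtains M where "\<And>u. inner (A u) u \<le> M * (norm u)\<^sup>2"
    "\<And>\<delta>. \<delta> > 0 \<Longrightarrow> \<exists>u. norm u = 1 \<and> norm (M *\<^sub>R u - A u) \<le> \<delta>"
proof -
  interpret A: bounded_linear A by fact
  obtain K0 where K0: "\<And>u. norm (A u) \<le> norm u * K0" using A.bounded by blast
  define X where "X = {inner (A u) u |u. norm u = 1}"
  define M where "M = Sup X"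
  have X: "X \<noteq> {}" using e by (auto simp: X_def)
  have bdd: "bdd_above X"
  proof (rule bdd_aboveI)
    fix y assume "y \<in> X"
    then obtain u where "norm u = 1" "y = inner (A u) u" by (auto simp: X_def)
    then show "y \<le> K0" using norm_cauchy_schwarz[of "A u" u] K0[of u] by simp
  qed
  have M: "inner (A u) u \<le> M * (norm u)\<^sup>2" for u
  proof (cases "u = 0")
    case False
    define w where "w = u /\<^sub>R norm u"
    have "norm w = 1" using False by (simp add: w_def)
    then have "inner (A w) w \<le> M" unfolding M_def by (intro cSup_upper bdd) (auto simp: X_def)
    then show ?thesis using False
      by (simp add: w_def A.scaleR divide_simps power2_eq_square mult.commute)
  qed simp
  define T where "T u = M *\<^sub>R u - A u" for u
  have Tsym: "inner (T u) v = inner u (T v)" for u v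
    by (simp add: T_def inner_diff_left inner_diff_right sym)
  have Tpos: "inner (T u) u \<ge> 0" for u
    using M[of u] by (simp add: T_def inner_diff_left power2_norm_eq_inner)
  define K where "K = \<bar>M\<bar> + \<bar>K0\<bar> + 1"
  have "K > 0" by (simp add: K_def)
  have Tbd: "norm (T u) \<le> K * norm u" for u
  proof -
    have "norm (T u) \<le> \<bar>M\<bar> * norm u + norm u * K0"
      unfolding T_def using K0[of u] norm_triangle_ineq4[of "M *\<^sub>R u" "A u"] by simp
    also have "norm u * K0 \<le> \<bar>K0\<bar> * norm u"
      using mult_left_mono[of K0 "\<bar>K0\<bar>" "norm u"] by (simp add: mult.commute)
    finally show ?thesis unfolding K_def distrib_right mult_1 using norm_ge_zero[of u] by linarith
  qed
  have Tlin: "T (u + r *\<^sub>R v) = T u + r *\<^sub>R T v" for u v r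
    by (simp add: T_def A.add A.scaleR algebra_simps)
  have key: "(norm (T u))\<^sup>2 \<le> K * inner (T u) u" for u
  proof -
    \<comment> \<open>Positivity at \<open>u - T u / K\<close> replaces Cauchy-Schwarz for the
      semidefinite form of \<open>T\<close>.\<close>
    have "0 \<le> inner (T (u + (- (1 / K)) *\<^sub>R T u)) (u + (- (1 / K)) *\<^sub>R T u)" by (rule Tpos)
    also have "\<dots> = inner (T u) u - 2 * (1 / K) * (norm (T u))\<^sup>2 + (1 / K)\<^sup>2 * inner (T (T u)) (T u)"
      unfolding Tlin power2_norm_eq_inner using Tsym[of "T u" u]
      by (simp add: inner_add_left inner_add_right power2_eq_square algebra_simps)
    also have "inner (T (T u)) (T u) \<le> K * (norm (T u))\<^sup>2"
      using norm_cauchy_schwarz[of "T (T u)" "T u"] mult_right_mono[OF Tbd[of "T u"], of "norm (T u)"]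
      by (simp add: power2_eq_square)
    finally have "0 \<le> inner (T u) u - 2 * (1 / K) * (norm (T u))\<^sup>2 + (1 / K)\<^sup>2 * (K * (norm (T u))\<^sup>2)"
      by (simp add: mult_left_mono)
    also have "\<dots> = inner (T u) u - (norm (T u))\<^sup>2 / K"
      using \<open>K > 0\<close> by (simp add: power2_eq_square field_simps)
    finally show ?thesis using \<open>K > 0\<close> by (simp add: field_simps)
  qed
  have "\<exists>u. norm u = 1 \<and> norm (M *\<^sub>R u - A u) \<le> \<delta>" if "\<delta> > 0" for \<delta>
  proof -
    have "M - \<delta>\<^sup>2 / K < Sup X" using that \<open>K > 0\<close> by (simp add: M_def)
    then obtain y where "y \<in> X" "M - \<delta>\<^sup>2 / K < y" using less_cSup_iff[OF X bdd] by blast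
    then obtain u where u: "norm u = 1" "M - \<delta>\<^sup>2 / K < inner (A u) u" by (auto simp: X_def)
    have "inner (T u) u = M - inner (A u) u"
      using u(1) by (simp add: T_def inner_diff_left dot_square_norm)
    then have "inner (T u) u \<le> \<delta>\<^sup>2 / K" using u(2) by simp
    then have "K * inner (T u) u \<le> K * (\<delta>\<^sup>2 / K)" using \<open>K > 0\<close> by (intro mult_left_mono) auto
    then have "(norm (T u))\<^sup>2 \<le> \<delta>\<^sup>2" using key[of u] \<open>K > 0\<close> by simp
    then show ?thesis using u(1) that unfolding T_def[symmetric] by (intro exI[of _ u]) (auto intro: power2_le_imp_le)
  qed
  with M show thesis by (rule that)
qed

section \<open>Resolvents and pseudospectra on \<open>ell2\<close>\<close>

lemma norm_scaleC: "norm (z *\<^sub>C u) = cmod z * norm u"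
  by (simp add: norm_ell2_def norm_mult power_mult_distrib infsum_cmult_right' real_sqrt_mult)

lemma bounded_linear_scaleC: "bounded_linear (\<lambda>u. z *\<^sub>C u)"
  by (intro bounded_linear_intro[where K = "cmod z"] ell2_eqI) (simp_all add: norm_scaleC algebra_simps)

lemma inner_scaleC: "inner (z *\<^sub>C u) v = inner u (cnj z *\<^sub>C v)"
  unfolding inner_ell2_def by (intro infsum_cong) (simp add: algebra_simps)

lemma scaleC_of_real: "complex_of_real r *\<^sub>C u = r *\<^sub>R u"
  by (rule ell2_eqI) (simp add: scaleR_conv_of_real)

text \<open>A lower bound for \<open>z - A\<close> is an upper bound for its inverse. Bijectivity is
  a separate hypothesis because the lower bound alone does not give surjectivity.\<close>

lemma resolvent_bound:
  assumes A: "bounded_clinear A" and bij: "bij (\<lambda>u. z *\<^sub>C u - A u)"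
    and \<delta>: "\<delta> > 0" "\<And>u. \<delta> * norm u \<le> norm (z *\<^sub>C u - A u)"
  shows "z \<in> resolvent_set A" and "onorm (resolvent A z) \<le> 1 / \<delta>"
proof -
  define T where "T u = z *\<^sub>C u - A u" for u
  define R where "R = inv T"
  have bijT: "bij T" using bij by (simp add: T_def[abs_def])
  have TR: "T (R u) = u" for u unfolding R_def using bijT by (simp add: bij_is_surj surj_f_inv_f)
  have RI: "T u = v \<Longrightarrow> R v = u" for u v unfolding R_def using bijT by (auto simp: bij_is_inj)
  interpret A: bounded_linear A using A by (simp add: bounded_clinear_def)
  interpret Z: bounded_linear "\<lambda>u. z *\<^sub>C u" by (rule bounded_linear_scaleC)
  have AC: "A (y *\<^sub>C u) = y *\<^sub>C A u" for y u using A by (simp add: bounded_clinear_def)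
  have add: "R (u + v) = R u + R v" for u v
    by (rule RI) (use TR[of u] TR[of v] in \<open>simp add: T_def A.add Z.add algebra_simps\<close>)
  have scaleC: "R (y *\<^sub>C u) = y *\<^sub>C R u" for y u
  proof (rule RI)
    have "T (y *\<^sub>C R u) = y *\<^sub>C T (R u)" by (rule ell2_eqI) (simp add: T_def AC algebra_simps)
    then show "T (y *\<^sub>C R u) = y *\<^sub>C u" by (simp add: TR)
  qed
  have bd: "norm (R u) \<le> norm u * (1 / \<delta>)" for u
    using \<delta>(2)[of "R u"] TR[of u] \<delta>(1) by (simp add: T_def field_simps)
  have "bounded_linear R"
    by (rule bounded_linear_intro[OF add _ bd]) (use scaleC[of "complex_of_real _"] in \<open>simp add: scaleC_of_real\<close>)
  then show "z \<in> resolvent_set A"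
    using bij scaleC by (simp add: resolvent_set_def bounded_clinear_def R_def T_def[abs_def])
  have "resolvent A z = R" by (simp add: resolvent_def R_def T_def[abs_def])
  then show "onorm (resolvent A z) \<le> 1 / \<delta>"
    using bd by (simp add: onorm_bound \<delta>(1) less_imp_le mult.commute)
qed

text \<open>The strict \<open>\<delta> > \<epsilon>\<close> is due to the pseudospectrum containing
  the points where the resolvent norm equals \<open>1 / \<epsilon>\<close>.\<close>

lemma not_in_pseudospectrum:
  assumes A: "bounded_clinear A" and bij: "bij (\<lambda>u. z *\<^sub>C u - A u)"
    and \<delta>: "\<delta> > \<epsilon>" "\<epsilon> \<ge> 0" "\<And>u. \<delta> * norm u \<le> norm (z *\<^sub>C u - A u)"
  shows "z \<notin> pseudospectrum \<epsilon> A"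
proof -
  have "\<delta> > 0" using \<delta> by simp
  note R = resolvent_bound[OF A bij this \<delta>(3)]
  have "1 / \<delta> < 1 / \<epsilon>" if "\<epsilon> > 0" using that \<delta>(1) by (simp add: frac_less2)
  then show ?thesis using R by (auto simp: pseudospectrum_def spectrum_def)
qed

text \<open>The defect may exceed \<open>\<epsilon>\<close> by any positive \<open>\<delta>\<close>,
  as extreme spectral points need not be eigenvalues. Off the spectrum the limit is
  \<open>1 \<le> onorm R * \<epsilon>\<close>, which also rules out
  \<open>\<epsilon> = 0\<close>.\<close>

lemma in_pseudospectrum:
  assumes \<epsilon>: "\<epsilon> \<ge> 0" and ap: "\<And>\<delta>. \<delta> > 0 \<Longrightarrow> \<exists>u. norm u = 1 \<and> norm (z *\<^sub>C u - A u) \<le> \<epsilon> + \<delta>"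
  shows "z \<in> pseudospectrum \<epsilon> A"
proof (cases "z \<in> spectrum A")
  case False
  define R where "R = resolvent A z"
  have bij: "bij (\<lambda>u. z *\<^sub>C u - A u)" and "bounded_clinear R"
    using False by (auto simp: spectrum_def resolvent_set_def R_def resolvent_def)
  then have R: "bounded_linear R" by (simp add: bounded_clinear_def)
  have RI: "R (z *\<^sub>C u - A u) = u" for u
    unfolding R_def resolvent_def using inv_f_f[OF bij_is_inj[OF bij], of u] by simp
  have *: "1 \<le> onorm R * (\<epsilon> + \<delta>)" if "\<delta> > 0" for \<delta>
  proof -
    obtain u where u: "norm u = 1" "norm (z *\<^sub>C u - A u) \<le> \<epsilon> + \<delta>" using ap[OF \<open>\<delta> > 0\<close>] by blast
    have "1 \<le> onorm R * norm (z *\<^sub>C u - A u)"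
      using onorm[OF R, of "z *\<^sub>C u - A u"] u(1) by (simp add: RI)
    also have "\<dots> \<le> onorm R * (\<epsilon> + \<delta>)" using u(2) onorm_pos_le[OF R] by (rule mult_left_mono)
    finally show ?thesis .
  qed
  have "onorm R \<noteq> 0" using *[of 1] by auto
  then have pos: "onorm R > 0" using onorm_pos_le[OF R] by simp
  have "1 \<le> onorm R * \<epsilon> + e" if "e > 0" for e
    using *[of "e / onorm R"] that pos by (simp add: distrib_left)
  then have "1 \<le> onorm R * \<epsilon>" by (rule field_le_epsilon)
  moreover from this have "\<epsilon> > 0" using \<epsilon> by (cases "\<epsilon> = 0") auto
  ultimately show ?thesis using False by (simp add: pseudospectrum_def R_def pos_divide_le_eq mult.commute)
qed (auto simp: pseudospectrum_def)

subsection \<open>The spectral gap of the symmetrized operator\<close>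

lemma norm_sq_finite_support:
  assumes "finite F" "\<And>n. n \<notin> F \<Longrightarrow> coord u n = 0"
  shows "(norm u)\<^sup>2 = (\<Sum>n\<in>F. (cmod (coord u n))\<^sup>2)"
proof -
  have "(\<Sum>\<^sub>\<infinity>n. (cmod (coord u n))\<^sup>2) = (\<Sum>\<^sub>\<infinity>n\<in>F. (cmod (coord u n))\<^sup>2)"
    by (rule infsum_cong_neutral) (use assms in auto)
  then show ?thesis using assms(1) by (simp add: norm_ell2_sq)
qed

lemma coord_Abs_finite_support:
  assumes "finite F" "\<And>n. n \<notin> F \<Longrightarrow> g n = 0"
  shows "coord (Abs_ell2 g) = g"
proof -
  have "finite {n \<in> UNIV. (cmod (g n))\<^sup>2 \<noteq> 0}"
    by (rule finite_subset[OF _ assms(1)]) (use assms(2) in auto)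
  then show ?thesis by (simp add: Abs_ell2_inverse finite_nonzero_values_imp_summable_on)
qed

text \<open>Truncations of \<open>u\<close> converge to \<open>u\<close>; this lets a continuous
  norm inequality pass from finitely supported sequences to all of \<open>ell2\<close>.\<close>

lemma finite_support_dense: "u \<in> closure {v. \<exists>K::nat. \<forall>l. \<bar>l\<bar> \<ge> int K \<longrightarrow> coord v l = 0}"
  unfolding closure_approachable
proof (intro allI impI)
  fix e :: real assume e: "e > 0"
  have "((\<lambda>n. (cmod (coord u n))\<^sup>2) has_sum (norm u)\<^sup>2) UNIV"
    unfolding norm_ell2_sq by (rule has_sum_infsum[OF coord_summable])
  then have "\<forall>\<^sub>F F in finite_subsets_at_top UNIV. dist (\<Sum>n\<in>F. (cmod (coord u n))\<^sup>2) ((norm u)\<^sup>2) < e\<^sup>2"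
    unfolding has_sum_def using e by (intro tendstoD) auto
  then obtain F where F: "finite F" "dist (\<Sum>n\<in>F. (cmod (coord u n))\<^sup>2) ((norm u)\<^sup>2) < e\<^sup>2"
    unfolding eventually_finite_subsets_at_top by auto
  define v where "v = Abs_ell2 (\<lambda>n. if n \<in> F then coord u n else 0)"
  have v: "coord v n = (if n \<in> F then coord u n else 0)" for n
    unfolding v_def by (subst coord_Abs_finite_support[OF F(1)]) auto
  have "(norm (v - u))\<^sup>2 = (\<Sum>\<^sub>\<infinity>n. (cmod (coord u n))\<^sup>2 + (- (cmod (coord v n))\<^sup>2))"
    unfolding norm_ell2_sq by (intro infsum_cong) (simp add: v)
  also have "\<dots> = (norm u)\<^sup>2 - (norm v)\<^sup>2"
    by (subst infsum_add) (simp_all add: coord_summable summable_on_uminus infsum_uminus norm_ell2_sq)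
  also have "(norm v)\<^sup>2 = (\<Sum>n\<in>F. (cmod (coord u n))\<^sup>2)"
    by (subst norm_sq_finite_support[OF F(1)]) (auto simp: v)
  finally have "(norm (v - u))\<^sup>2 < e\<^sup>2" using F(2) by (simp add: dist_real_def)
  then have "dist v u < e" using e by (simp add: dist_norm power2_less_imp_less)
  moreover have "\<exists>K::nat. \<forall>l. \<bar>l\<bar> \<ge> int K \<longrightarrow> coord v l = 0"
  proof -
    have "bdd_above (abs ` F)" using F(1) by simp
    then obtain K where K: "\<And>l. l \<in> F \<Longrightarrow> \<bar>l\<bar> \<le> K" by (auto simp: bdd_above_def)
    show ?thesis
    proof (intro exI[of _ "nat (K + 1)"] allI impI)
      fix l assume "int (nat (K + 1)) \<le> \<bar>l\<bar>"
      then have "\<not> \<bar>l\<bar> \<le> K" by linarith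
      then show "coord v l = 0" using K by (auto simp: v)
    qed
  qed
  ultimately show "\<exists>v\<in>{v. \<exists>K::nat. \<forall>l. \<bar>l\<bar> \<ge> int K \<longrightarrow> coord v l = 0}. dist v u < e" by blast
qed

lemma infsum_translate: "(\<Sum>\<^sub>\<infinity>n. g (n + m)) = (\<Sum>\<^sub>\<infinity>n. g n)" for g :: "int \<Rightarrow> real" and m :: int
proof -
  have "bij (\<lambda>n::int. n + m)"
    by (rule bij_betwI[of _ _ _ "\<lambda>n. n - m"]) auto
  then show ?thesis by (rule infsum_reindex_bij_betw)
qed

section \<open>Transposes, symmetrization and lower bounds for Jacobi operators\<close>

lemma periodic_const [simp]: "periodic p (\<lambda>_. r)"
  by (simp add: periodic_def)

text \<open>The coefficients are real, so the adjoint is the transpose, which exchanges the two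
  off-diagonals. Each off-diagonal part is treated by shifting the summation index.\<close>

lemma jacobi_adjoint:
  assumes per: "periodic p a" "periodic p b" "periodic p c" and p: "p > 0"
  shows "inner (jacobi a b c u) v = inner u (jacobi a c b v)"
proof -
  let ?o = "\<lambda>_::int. 0::real"
  have z: "periodic p ?o" by simp
  have split: "jacobi a b c u = jacobi a ?o ?o u + jacobi ?o b ?o u + jacobi ?o ?o c u"
    if per: "periodic p a" "periodic p b" "periodic p c" for a b c u
    by (rule ell2_eqI) (simp add: coord_jacobi[OF _ _ _ p] per)
  have diag: "inner (jacobi a ?o ?o u) v = inner u (jacobi a ?o ?o v)"
    unfolding inner_ell2_def coord_jacobi[OF per(1) z z p] by (intro infsum_cong) (simp add: algebra_simps)
  have off: "inner (jacobi ?o b ?o u) v = inner u (jacobi ?o ?o b v)" if b: "periodic p b" for b u v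
  proof -
    have "inner (jacobi ?o b ?o u) v = (\<Sum>\<^sub>\<infinity>n. Re (complex_of_real (b n) * coord u (n + 1) * cnj (coord v n)))"
      unfolding inner_ell2_def coord_jacobi[OF z b z p] by simp
    also have "\<dots> = (\<Sum>\<^sub>\<infinity>n. Re (complex_of_real (b (n + 1 - 1)) * coord u (n + 1) * cnj (coord v (n + 1 - 1))))"
      by simp
    also have "\<dots> = (\<Sum>\<^sub>\<infinity>n. Re (complex_of_real (b (n - 1)) * coord u n * cnj (coord v (n - 1))))"
      by (rule infsum_translate)
    also have "\<dots> = inner u (jacobi ?o ?o b v)"
      unfolding inner_ell2_def coord_jacobi[OF z z b p] by (intro infsum_cong) (simp add: algebra_simps)
    finally show ?thesis .
  qed
  show ?thesis
    unfolding split[OF per] split[OF per(1,3,2)]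
    using diag off[OF per(2), of u v] off[OF per(3), of v u]
    by (simp add: inner_add_left inner_add_right inner_commute)
qed

text \<open>The difference is \<open>k / 2\<close> times the difference of the two unit shifts, both
  isometries; they are written as Jacobi operators themselves.\<close>

lemma jacobi_symmetrization_norm:
  assumes per: "periodic p a" "periodic p b" "periodic p c" "periodic p d" and p: "p > 0"
    and bd: "\<And>i. b i = d i + k / 2" "\<And>i. c i = d i - k / 2"
  shows "norm (jacobi a b c u - jacobi a d d u) \<le> \<bar>k\<bar> * norm u"
proof -
  let ?o = "\<lambda>_::int. 0::real" and ?i = "\<lambda>_::int. 1::real"
  have z: "periodic p ?o" "periodic p ?i" by simp_all
  define up where "up = jacobi ?o ?i ?o u"
  define dn where "dn = jacobi ?o ?o ?i u"
  have c: "coord up n = coord u (n + 1)" "coord dn n = coord u (n - 1)" for n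
    by (simp_all add: up_def dn_def coord_jacobi[OF _ _ _ p])
  have "norm up = norm u" "norm dn = norm u"
    using infsum_translate[of "\<lambda>n. (cmod (coord u n))\<^sup>2" 1] infsum_translate[of "\<lambda>n. (cmod (coord u n))\<^sup>2" "-1"]
    by (simp_all add: norm_ell2_def c)
  then have n: "norm (up - dn) \<le> 2 * norm u" using norm_triangle_ineq4[of up dn] by simp
  have "jacobi a b c u - jacobi a d d u = (k / 2) *\<^sub>R (up - dn)"
    by (rule ell2_eqI)
       (simp add: c coord_jacobi[OF per(1,2,3) p] coord_jacobi[OF per(1,4,4) p] bd scaleR_conv_of_real algebra_simps)
  then have "norm (jacobi a b c u - jacobi a d d u) = \<bar>k\<bar> / 2 * norm (up - dn)" by simp
  also have "\<dots> \<le> \<bar>k\<bar> / 2 * (2 * norm u)" using n by (intro mult_left_mono) auto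
  finally show ?thesis by simp
qed

text \<open>The operator is real, so real and imaginary parts of a finitely supported vector are
  handled separately by \<open>finite_support_gap\<close>; density does the rest.\<close>

lemma jacobi_gap_real:
  assumes per: "periodic (Suc q) a" "periodic (Suc q) d"
    and eb: "eigenbasis q (dirichlet a d n) v \<mu>" "eigenbasis q (dirichlet a d m) v' \<mu>'"
    and j: "j < q" "\<mu> j = x - h" "\<mu>' j = x + h" and h: "h > 0"
  shows "h * norm u \<le> norm (jacobi a d d u - x *\<^sub>R u)"
proof -
  define B where "B u = jacobi a d d u - x *\<^sub>R u" for u
  have "bounded_linear (jacobi a d d)"
    using bounded_clinear_jacobi[OF per(1,2,2)] by (simp add: bounded_clinear_def)
  then have B: "bounded_linear B" unfolding B_def
    by (intro bounded_linear_sub bounded_linear_scaleR_right)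
  have fin: "h * norm u \<le> norm (B u)" if K: "\<And>l. \<bar>l\<bar> \<ge> int K \<Longrightarrow> coord u l = 0" for u K
  proof (rule power2_le_imp_le)
    let ?F = "{- int K..int K}"
    define f where "f l = Re (coord u l)" for l
    define g where "g l = Im (coord u l)" for l
    have Bc: "Re (coord (B u) l) = tridiag a d f l - x * f l" "Im (coord (B u) l) = tridiag a d g l - x * g l" for l
      by (simp_all add: B_def tridiag_def f_def g_def coord_jacobi[OF per(1,2,2)])
    have u0: "coord u l = 0" and B0: "coord (B u) l = 0" if "l \<notin> ?F" for l
    proof -
      have "int K \<le> \<bar>l\<bar>" "int K \<le> \<bar>l - 1\<bar>" "int K \<le> \<bar>l + 1\<bar>" using that by auto
      then show "coord u l = 0" "coord (B u) l = 0"
        using K by (simp_all add: B_def coord_jacobi[OF per(1,2,2)])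
    qed
    have "h\<^sup>2 * (norm u)\<^sup>2 = h\<^sup>2 * (\<Sum>l\<in>?F. (f l)\<^sup>2) + h\<^sup>2 * (\<Sum>l\<in>?F. (g l)\<^sup>2)"
      by (subst norm_sq_finite_support[of ?F]) (use u0 in \<open>auto simp: cmod_power2 f_def g_def sum.distrib distrib_left\<close>)
    also have "\<dots> \<le> (\<Sum>l\<in>?F. (tridiag a d f l - x * f l)\<^sup>2) + (\<Sum>l\<in>?F. (tridiag a d g l - x * g l)\<^sup>2)"
      by (intro add_mono finite_support_gap[OF per eb j h]) (use K in \<open>auto simp: f_def g_def\<close>)
    also have "\<dots> = (norm (B u))\<^sup>2"
      by (subst norm_sq_finite_support[of ?F]) (use B0 in \<open>auto simp: cmod_power2 Bc sum.distrib\<close>)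
    finally show "(h * norm u)\<^sup>2 \<le> (norm (B u))\<^sup>2" by (simp add: power_mult_distrib)
  qed simp
  have "closed {u. h * norm u \<le> norm (B u)}"
    by (intro closed_Collect_le continuous_intros linear_continuous_on B)
  moreover have "{v. \<exists>K::nat. \<forall>l. \<bar>l\<bar> \<ge> int K \<longrightarrow> coord v l = 0} \<subseteq> {u. h * norm u \<le> norm (B u)}"
    using fin by blast
  ultimately have "u \<in> {u. h * norm u \<le> norm (B u)}"
    using finite_support_dense[of u] closure_minimal by blast
  then show ?thesis by (simp add: B_def)
qed

text \<open>The imaginary part of \<open>z\<close> adds a skew term to the symmetric
  \<open>B\<close>. The two images of \<open>u\<close> are orthogonal in the real inner product, so
  the norm can only grow.\<close>

lemma jacobi_gap_complex:
  assumes per: "periodic p a" "periodic p d" and p: "p > 0"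
    and gap: "\<And>u. h * norm u \<le> norm (jacobi a d d u - x *\<^sub>R u)" and h: "h \<ge> 0" and z: "Re z = x"
  shows "h * norm u \<le> norm (z *\<^sub>C u - jacobi a d d u)"
proof (rule power2_le_imp_le)
  define B where "B u = jacobi a d d u - x *\<^sub>R u" for u
  have Bsym: "inner (B u) v = inner u (B v)" for u v
    by (simp add: B_def inner_diff_left inner_diff_right jacobi_adjoint[OF per(1,2,2) p])
  have BC: "B (y *\<^sub>C u) = y *\<^sub>C B u" for y u
    by (rule ell2_eqI) (simp add: B_def coord_jacobi[OF per(1,2,2) p] scaleR_conv_of_real algebra_simps)
  let ?w = "(\<i> * complex_of_real (Im z)) *\<^sub>C u"
  have eq: "z *\<^sub>C u - jacobi a d d u = ?w - B u"
    by (rule ell2_eqI)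
       (simp add: B_def coord_jacobi[OF per(1,2,2) p] scaleR_conv_of_real complex_eq_iff z[symmetric] algebra_simps)
  \<comment> \<open>The cross term turns out to equal its own negative.\<close>
  have "inner ?w (B u) = inner u (cnj (\<i> * complex_of_real (Im z)) *\<^sub>C B u)"
    by (rule inner_scaleC)
  also have "\<dots> = - inner u ((\<i> * complex_of_real (Im z)) *\<^sub>C B u)"
    by (subst inner_minus_right[symmetric]) (intro arg_cong[of _ _ "inner u"] ell2_eqI, simp)
  also have "\<dots> = - inner (B u) ?w" unfolding BC[symmetric] Bsym ..
  finally have "inner ?w (B u) = 0" by (simp add: inner_commute)
  then have "(norm (?w - B u))\<^sup>2 = (norm ?w)\<^sup>2 + (norm (B u))\<^sup>2"
    unfolding power2_norm_eq_inner by (simp add: inner_diff_left inner_diff_right inner_commute)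
  moreover have "(h * norm u)\<^sup>2 \<le> (norm (B u))\<^sup>2"
    using gap[of u] h by (intro power_mono) (auto simp: B_def)
  ultimately show "(h * norm u)\<^sup>2 \<le> (norm (z *\<^sub>C u - jacobi a d d u))\<^sup>2"
    unfolding eq using zero_le_power2[of "norm ?w"] by linarith
qed simp

text \<open>An eigenvector of the Dirichlet matrix, extended by zero, shows that its eigenvalue lies
  in the numerical range of the symmetric operator.\<close>

lemma dirichlet_test_vector:
  assumes per: "periodic (Suc q) a" "periodic (Suc q) d"
    and eb: "eigenbasis q (dirichlet a d n) v \<mu>" and j: "j < q"
  obtains u where "norm u = 1" "inner (jacobi a d d u) u = \<mu> j"
proof -
  define f where "f l = (if n < l \<and> l \<le> n + int q then v j (nat (l - n - 1)) else 0)" for l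
  define F where "F = (\<lambda>i. n + 1 + int i) ` {..<Suc q}"
  have F0: "f l = 0" if "l \<notin> F" for l
  proof (rule ccontr)
    assume "f l \<noteq> 0"
    then have "n < l" "l \<le> n + int q" by (auto simp: f_def split: if_splits)
    then have "l = n + 1 + int (nat (l - n - 1))" "nat (l - n - 1) < Suc q" by auto
    then show False using that unfolding F_def by blast
  qed
  have "finite F" by (simp add: F_def)
  have sumF: "(\<Sum>l\<in>F. g l) = (\<Sum>i<Suc q. g (n + 1 + int i))" for g :: "int \<Rightarrow> real"
    unfolding F_def by (subst sum.reindex) (auto simp: inj_on_def)
  define u where "u = Abs_ell2 (\<lambda>l. complex_of_real (f l))"
  have u: "coord u l = complex_of_real (f l)" for l
    unfolding u_def by (subst coord_Abs_finite_support[OF \<open>finite F\<close>]) (use F0 in auto)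
  have "f n = 0" "f (n + int (Suc q)) = 0" by (simp_all add: f_def)
  note energy = block_energy[OF eb _ this, of "{j}" "\<lambda>_. 1"]
  have "(norm u)\<^sup>2 = (\<Sum>l\<in>F. (f l)\<^sup>2)"
    by (subst norm_sq_finite_support[OF \<open>finite F\<close>]) (use F0 in \<open>auto simp: u\<close>)
  also have "\<dots> = 1" unfolding sumF by (subst energy(2)) (use j in \<open>auto simp: f_def\<close>)
  finally have "norm u = 1" using norm_ge_zero[of u] by (simp add: power2_eq_1_iff)
  have "inner (jacobi a d d u) u = (\<Sum>\<^sub>\<infinity>l. tridiag a d f l * f l)"
    unfolding inner_ell2_def by (intro infsum_cong) (simp add: coord_jacobi[OF per(1,2,2)] u tridiag_def)
  also have "\<dots> = (\<Sum>\<^sub>\<infinity>l\<in>F. tridiag a d f l * f l)"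
    by (rule infsum_cong_neutral) (use F0 in auto)
  also have "\<dots> = (\<Sum>l\<in>F. tridiag a d f l * f l)" using \<open>finite F\<close> by simp
  also have "\<dots> = \<mu> j" unfolding sumF by (subst energy(1)) (use j in \<open>auto simp: f_def\<close>)
  finally have "inner (jacobi a d d u) u = \<mu> j" .
  with \<open>norm u = 1\<close> show thesis by (rule that)
qed

text \<open>Were the bound violated, the vertical line through the midpoint \<open>x\<close> would
  miss the pseudospectrum, although real points of it lie on both sides.\<close>

theorem dirichlet_eigenvalue_gap:
  fixes k :: real
  assumes per: "periodic (Suc q) a" "periodic (Suc q) b" "periodic (Suc q) c" "periodic (Suc q) d"
    and bd: "\<And>i. b i = d i + k / 2" "\<And>i. c i = d i - k / 2"
    and \<epsilon>: "\<epsilon> \<ge> \<bar>k\<bar>" and pc: "path_connected (pseudospectrum \<epsilon> (jacobi a b c))"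
    and eb: "eigenbasis q (dirichlet a d n) v \<mu>" "eigenbasis q (dirichlet a d m) v' \<mu>'"
    and j: "j < q"
  shows "\<mu>' j - \<mu> j \<le> 2 * (\<epsilon> + \<bar>k\<bar>)"
proof (rule ccontr)
  assume neg: "\<not> \<mu>' j - \<mu> j \<le> 2 * (\<epsilon> + \<bar>k\<bar>)"
  define x where "x = (\<mu> j + \<mu>' j) / 2"
  define h where "h = (\<mu>' j - \<mu> j) / 2"
  have xh: "\<mu> j = x - h" "\<mu>' j = x + h" by (simp_all add: x_def h_def field_simps)
  have h: "h > \<epsilon> + \<bar>k\<bar>" "h > 0" "\<epsilon> \<ge> 0" using neg \<epsilon> by (auto simp: h_def)
  define S where "S = jacobi a d d"
  define J where "J = jacobi a b c"
  define J' where "J' = jacobi a c b"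
  have bl: "bounded_linear S" "bounded_clinear J" "bounded_linear J" "bounded_linear J'"
    using bounded_clinear_jacobi[of "Suc q", OF per(1,4,4)] bounded_clinear_jacobi[of "Suc q", OF per(1,2,3)]
      bounded_clinear_jacobi[of "Suc q", OF per(1,3,2)]
    by (simp_all add: S_def J_def J'_def bounded_clinear_def)
  have JS: "norm (J u - S u) \<le> \<bar>k\<bar> * norm u" for u
    unfolding S_def J_def by (rule jacobi_symmetrization_norm[OF per _ bd]) simp
  \<comment> \<open>The transpose exchanges \<open>b\<close> and \<open>c\<close>, which changes
    \<open>k\<close> to \<open>- k\<close>.\<close>
  have J'S: "norm (J' u - S u) \<le> \<bar>k\<bar> * norm u" for u
    unfolding S_def J'_def using jacobi_symmetrization_norm[OF per(1,3,2,4), of "- k" u] bd by simp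
  have Sgap: "h * norm u \<le> norm (z *\<^sub>C u - S u)" if "Re z = x" for u z
    unfolding S_def
    by (rule jacobi_gap_complex[OF per(1,4) _ jacobi_gap_real[OF per(1,4) eb j xh h(2)] _ that]) (use h in auto)
  \<comment> \<open>Stated for a generic \<open>J0\<close> to serve both \<open>J\<close> and its
    transpose, as \<open>coercive_adjoint_pair_bij\<close> demands.\<close>
  have gap: "(h - \<bar>k\<bar>) * norm u \<le> norm (z *\<^sub>C u - J0 u)"
    if "Re z = x" "norm (J0 u - S u) \<le> \<bar>k\<bar> * norm u" for u z J0
  proof -
    have "h * norm u \<le> norm (z *\<^sub>C u - S u)" by (rule Sgap) fact
    also have "z *\<^sub>C u - S u = (z *\<^sub>C u - J0 u) + (J0 u - S u)" by simp
    also have "norm \<dots> \<le> norm (z *\<^sub>C u - J0 u) + norm (J0 u - S u)" by (rule norm_triangle_ineq)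
    finally show ?thesis using that(2) by (simp add: left_diff_distrib)
  qed
  have notin: "z \<notin> pseudospectrum \<epsilon> J" if z: "Re z = x" for z
  proof (rule not_in_pseudospectrum[OF bl(2)])
    show "bij (\<lambda>u. z *\<^sub>C u - J u)"
    proof (rule coercive_adjoint_pair_bij)
      show "bounded_linear (\<lambda>u. z *\<^sub>C u - J u)" "bounded_linear (\<lambda>u. cnj z *\<^sub>C u - J' u)"
        by (intro bounded_linear_sub bounded_linear_scaleC bl)+
      show "inner (z *\<^sub>C u - J u) w = inner u (cnj z *\<^sub>C w - J' w)" for u w
        unfolding J_def J'_def using jacobi_adjoint[OF per(1-3)]
        by (simp add: inner_diff_left inner_diff_right inner_scaleC)
      show "h - \<bar>k\<bar> > 0" using h by simp
      show "(h - \<bar>k\<bar>) * norm u \<le> norm (z *\<^sub>C u - J u)" for u by (rule gap[OF z JS])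
      show "(h - \<bar>k\<bar>) * norm u \<le> norm (cnj z *\<^sub>C u - J' u)" for u by (rule gap[OF _ J'S]) (simp add: z)
    qed
    show "(h - \<bar>k\<bar>) * norm u \<le> norm (z *\<^sub>C u - J u)" for u by (rule gap[OF z JS])
  qed (use h in auto)
  \<comment> \<open>Here \<open>\<epsilon> \<ge> \<bar>k\<bar>\<close> enters: an approximate
    eigenvector of \<open>S\<close> has defect at most \<open>\<bar>k\<bar> + \<delta>\<close> for
    \<open>J\<close>.\<close>
  have approx: "complex_of_real M \<in> pseudospectrum \<epsilon> J"
    if ap: "\<And>\<delta>. \<delta> > 0 \<Longrightarrow> \<exists>u. norm u = 1 \<and> norm (M *\<^sub>R u - S u) \<le> \<delta>" for M
  proof (rule in_pseudospectrum[OF h(3)])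
    fix \<delta> :: real assume "\<delta> > 0"
    obtain u where u: "norm u = 1" "norm (M *\<^sub>R u - S u) \<le> \<delta>" using ap[OF \<open>\<delta> > 0\<close>] by blast
    have "norm (M *\<^sub>R u - J u) = norm ((M *\<^sub>R u - S u) - (J u - S u))" by simp
    also have "\<dots> \<le> norm (M *\<^sub>R u - S u) + norm (J u - S u)" by (rule norm_triangle_ineq4)
    also have "\<dots> \<le> \<epsilon> + \<delta>" using u JS[of u] \<epsilon> by simp
    finally show "\<exists>u. norm u = 1 \<and> norm (complex_of_real M *\<^sub>C u - J u) \<le> \<epsilon> + \<delta>"
      using u(1) by (auto simp: scaleC_of_real)
  qed
  have sym: "inner (S u) w = inner u (S w)" for u w
    unfolding S_def by (rule jacobi_adjoint[OF per(1,4,4)]) simp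
  obtain e where e: "norm e = 1" "inner (S e) e = \<mu> j"
    using dirichlet_test_vector[OF per(1,4) eb(1) j] unfolding S_def by blast
  obtain e' where e': "norm e' = 1" "inner (S e') e' = \<mu>' j"
    using dirichlet_test_vector[OF per(1,4) eb(2) j] unfolding S_def by blast
  obtain M where M: "\<And>u. inner (S u) u \<le> M * (norm u)\<^sup>2"
    "\<And>\<delta>. \<delta> > 0 \<Longrightarrow> \<exists>u. norm u = 1 \<and> norm (M *\<^sub>R u - S u) \<le> \<delta>"
    using selfadjoint_sup_approx_eigenvalue[OF bl(1) sym e(1)] by blast
  have "x \<le> M" using M(1)[of e'] e' xh h by simp
  \<comment> \<open>The supremum for \<open>- S\<close>, so \<open>- M'\<close> is the lower end of
    the numerical range of \<open>S\<close>.\<close>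
  obtain M' where M': "\<And>u. inner (- S u) u \<le> M' * (norm u)\<^sup>2"
    "\<And>\<delta>. \<delta> > 0 \<Longrightarrow> \<exists>u. norm u = 1 \<and> norm (M' *\<^sub>R u - (- S u)) \<le> \<delta>"
    using selfadjoint_sup_approx_eigenvalue[of "\<lambda>u. - S u", OF bounded_linear_minus[OF bl(1)] _ e(1)] sym
    by auto
  have "- M' \<le> x" using M'(1)[of e] e xh h by simp
  have "norm (- M' *\<^sub>R u - S u) = norm (M' *\<^sub>R u - (- S u))" for u
    using norm_minus_cancel[of "M' *\<^sub>R u + S u"] by simp
  then have "complex_of_real (- M') \<in> pseudospectrum \<epsilon> J"
    using M'(2) by (intro approx) simp
  moreover have "complex_of_real M \<in> pseudospectrum \<epsilon> J" using M(2) by (intro approx) simp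
  moreover have "connected (Re ` pseudospectrum \<epsilon> J)"
    using pc unfolding J_def[symmetric]
    by (intro connected_continuous_image path_connected_imp_connected continuous_intros)
  ultimately have "{- M'..M} \<subseteq> Re ` pseudospectrum \<epsilon> J"
    by (intro connected_contains_Icc) (auto intro: rev_image_eqI)
  then have "x \<in> Re ` pseudospectrum \<epsilon> J" using \<open>x \<le> M\<close> \<open>- M' \<le> x\<close> by auto
  then show False using notin by blast
qed

theorem theorem3p7:
  fixes p :: nat and a b c :: "int \<Rightarrow> real" and k \<epsilon> :: real
  assumes "p \<ge> 1"
    and "periodic p a" and "periodic p b" and "periodic p c"
    and "\<forall>i\<in>{0..<int p}. b i - c i = k"
    and "\<epsilon> \<ge> \<bar>k\<bar>"
    and "path_connected (pseudospectrum \<epsilon> (jacobi a b c))"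
  shows "oscillation a \<le> 2 * (\<epsilon> + \<bar>k\<bar>) * (real p - 1)"
proof -
  obtain q where q: "p = Suc q" using assms(1) by (cases p) auto
  note per = assms(2-4)[unfolded q]
  define d where "d i = (b i + c i) / 2" for i
  have perd: "periodic (Suc q) d" using per by (simp add: periodic_def d_def)
  have "periodic (Suc q) (\<lambda>i. b i - c i)" using per by (simp add: periodic_def)
  \<comment> \<open>The relation \<open>b i - c i = k\<close>, given on one period, extends to all
    integers.\<close>
  from periodic_range[OF this] have "range (\<lambda>i. b i - c i) \<subseteq> {k}"
    using assms(5) by (auto simp: q)
  then have bc: "b i - c i = k" for i by blast
  have bd: "b i = d i + k / 2" "c i = d i - k / 2" for i
    using bc[of i] by (simp_all add: d_def field_simps)
  have main: "a n - a m \<le> 2 * (\<epsilon> + \<bar>k\<bar>) * (real p - 1)" for n m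
  proof -
    \<comment> \<open>The Dirichlet matrix omits exactly the site \<open>n\<close> of one period, so
      its trace is the period sum minus \<open>a n\<close>.\<close>
    have basis: "\<exists>v \<mu>. eigenbasis q (dirichlet a d n) v \<mu> \<and>
      (\<Sum>s<q. \<mu> s) = (\<Sum>i<Suc q. a (int i)) - a n" for n
    proof -
      obtain v \<mu> where 1: "eigenbasis q (dirichlet a d n) v \<mu>"
        and 2: "(\<Sum>s<q. \<mu> s) = (\<Sum>i<q. dirichlet a d n i i)"
        by (rule ordered_eigenbasis[of "dirichlet a d n" q, OF dirichlet_commute])
      have "(\<Sum>i<Suc q. a (int i)) = (\<Sum>i<Suc q. a (n + int i))"
        by (rule sum_periodic_shift[OF per(1), symmetric])
      also have "\<dots> = a n + (\<Sum>i<q. a (n + 1 + int i))"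
        by (subst sum.lessThan_Suc_shift) (simp add: algebra_simps)
      finally have "(\<Sum>i<q. dirichlet a d n i i) = (\<Sum>i<Suc q. a (int i)) - a n"
        by (simp add: dirichlet_def)
      with 1 2 show ?thesis by auto
    qed
    obtain v \<mu> where n: "eigenbasis q (dirichlet a d n) v \<mu>"
      "(\<Sum>s<q. \<mu> s) = (\<Sum>i<Suc q. a (int i)) - a n" using basis by blast
    obtain v' \<mu>' where m: "eigenbasis q (dirichlet a d m) v' \<mu>'"
      "(\<Sum>s<q. \<mu>' s) = (\<Sum>i<Suc q. a (int i)) - a m" using basis by blast
    have "a n - a m = (\<Sum>s<q. \<mu>' s - \<mu> s)"
      using n(2) m(2) by (simp add: sum_subtractf)
    \<comment> \<open>The gap bound is one-sided and holds for each of the \<open>q = p - 1\<close>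
      indices, whatever the sign of the difference.\<close>
    also have "\<dots> \<le> (\<Sum>s<q. 2 * (\<epsilon> + \<bar>k\<bar>))"
      using dirichlet_eigenvalue_gap[OF per perd bd assms(6,7) n(1) m(1)] by (intro sum_mono) simp
    finally show ?thesis by (simp add: q mult.commute)
  qed
  have "\<bar>a (int i) - a (int j)\<bar> \<le> 2 * (\<epsilon> + \<bar>k\<bar>) * (real p - 1)" for i j
    using main[of "int i" "int j"] main[of "int j" "int i"] by (simp add: abs_le_iff)
  then show ?thesis
    unfolding oscillation_def using finite_oscillation[of p a] assms(1,2) by (subst Max_le_iff) auto
qed

end
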